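(* There exists an absolute constant $N_0 \in \mathbf{N}$ such that for every real $K > 0$ there is a constant $c_K > 0$, depending only on $K$, with the following property. Let $N \geq N_0$ be an integer and let $A \subset \mathbf{Z}$ be a finite set of size $N$ such that $\|\widehat{1_A}\|_1 \leq K \log N$. Then there exists a (finite) arithmetic progression $P \subset \mathbf{Z}$ of length at least $N^{c_K}$ such that $|A \cap P| \geq c_K |P|$.
   Context: For a finite set $A \subset \mathbf{Z}$, $1_A$ is its indicator function, $\widehat{1_A}(\theta) = \sum_{n \in A} e^{-2\pi i n\theta}$ for $\theta \in \mathbf{R}/\mathbf{Z}$, and $\|\widehat{1_A}\|_1 = \int_0^1 |\widehat{1_A}(\theta)|\,d\theta$. An arithmetic progression of length $k$ is a set $\{a, a+d, \dots, a+(k-1)d\}$ with $a, d \in \mathbf{Z}$, $d \neq 0$; its length is its number of elements $|P| = k$. $\log$ is the natural logarithm. *)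

theory Defs
  imports "HOL-Analysis.Analysis"
begin

definition indicator_hat :: "int set \<Rightarrow> real \<Rightarrow> complex" where
  "indicator_hat A \<theta> = (\<Sum>n\<in>A. exp (- 2 * complex_of_real pi * \<i> * of_int n * complex_of_real \<theta>))"

definition indicator_hat_L1 :: "int set \<Rightarrow> real" where
  "indicator_hat_L1 A = integral {0..1} (\<lambda>\<theta>. norm (indicator_hat A \<theta>))"

text \<open>The difference \<open>d\<close> is nonzero, so the length \<open>k\<close> of the progression is \<^term>\<open>card P\<close>.\<close>

definition arith_progression :: "int set \<Rightarrow> bool" where
  "arith_progression P \<longleftrightarrow>
     (\<exists>(a::int) (d::int) (k::nat). d \<noteq> 0 \<and> k \<ge> 1 \<and> P = {a + int i * d | i. i < k})"

end

theory Submission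
  imports
    Defs
    "HOL-Complex_Analysis.Cauchy_Integral_Formula"
    "HOL-Library.Set_Algebras"
    "HOL-Computational_Algebra.Primes"
begin

text \<open>
The proof shows that a set with small transform norm has an initial segment with large additive energy, and then extracts a
progression from additive energy by standard tools of additive combinatorics.

For the first part (\<open>L1_norm_ge_of_low_energy_initial_segments\<close>), order \<open>A\<close> and let \<open>B k\<close> be its first \<open>4 ^ k\<close>
elements.  The proof by McGehee, Pigno and Smith of the Littlewood conjecture constructs a bounded function, with one-sided
spectrum at every scale \<open>k\<close>, whose correlation with the transform of \<open>A\<close> gains a constant at each of the
about \<open>ln N\<close> scales.  Here the building block at scale \<open>k\<close> is the whole transform of \<open>B k\<close>, divided by
\<open>sqrt \<delta> * 4 ^ k\<close> up to a constant and damped by the exponential of a holomorphic function.  If \<open>B k\<close> has energy at most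
\<open>\<delta> * (4 ^ k) ^ 3\<close>, the transform is rarely larger than \<open>sqrt \<delta> * 4 ^ k\<close>, the damping is harmless, and the scale contributes
a multiple of \<open>1 / sqrt \<delta>\<close> instead of a constant.  A norm of at most \<open>K * ln N\<close> therefore forces some \<open>B k\<close>,
of size at least a power of \<open>N\<close>, to have energy at least \<open>\<delta> * (card (B k)) ^ 3\<close> with \<open>\<delta>\<close> depending only on \<open>K\<close>
(\<open>high_energy_subset_of_small_L1_norm\<close>).

For the second part, \<open>balog_szemeredi_gowers\<close> gives a proportional subset \<open>B'\<close> with small difference set, and
\<open>card_iterated_difference_set_le\<close> makes \<open>5 B' - 5 B'\<close> small.  A weak form of Freiman's theorem
(\<open>progression_in_2B_minus_2B\<close>) finds a progression whose length is a power of \<open>card B'\<close> inside \<open>2 B' - 2 B'\<close>: a dilation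
modulo a large prime makes \<open>B'\<close> dense at a suitable scale, Bogolyubov's lemma reduces to boundedly many frequencies, and the
pigeonhole principle finds a common difference whose phases at all of them are close to integers.  Since \<open>3 B' - 2 B'\<close> is small,
\<open>B'\<close> has positive density on a translate of this progression
(\<open>dense_progression_of_small_iterated_sumsets\<close>).  For bounded \<open>N\<close> any two elements of \<open>A\<close> form a long
enough progression once \<open>c\<close> is small.
\<close>

section \<open>Exponential sums as functions on the circle\<close>

text \<open>
With \<open>z = zcirc \<theta>\<close> the transform of \<open>A\<close> is the Laurent polynomial \<open>\<Sum>n\<in>A. z powi n\<close>, so that
questions about which frequencies occur become questions about holomorphy in \<open>z\<close>.
\<close>
definition zcirc :: "real \<Rightarrow> complex" where
  "zcirc \<theta> = exp (- 2 * complex_of_real pi * \<i> * complex_of_real \<theta>)"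

lemma zcirc_nonzero [simp]: "zcirc \<theta> \<noteq> 0"
  by (simp add: zcirc_def)

lemma norm_zcirc [simp]: "norm (zcirc \<theta>) = 1"
  by (simp add: zcirc_def norm_exp_eq_Re)

lemma cnj_zcirc: "cnj (zcirc \<theta>) = inverse (zcirc \<theta>)"
  by (simp add: zcirc_def exp_cnj flip: exp_minus)

lemma cnj_zcirc_powi: "cnj (zcirc \<theta> powi n) = zcirc \<theta> powi (- n)"
  by (simp add: cnj_zcirc power_int_minus power_int_inverse)

lemma continuous_on_zcirc [continuous_intros]:
  "continuous_on S g \<Longrightarrow> continuous_on S (\<lambda>x. zcirc (g x))"
  unfolding zcirc_def by (intro continuous_intros)

lemma indicator_hat_eq: "indicator_hat A \<theta> = (\<Sum>n\<in>A. zcirc \<theta> powi n)"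
  unfolding indicator_hat_def zcirc_def
  by (intro sum.cong refl) (simp add: exp_power_int mult_ac)

lemma continuous_on_indicator_hat [continuous_intros]:
  "continuous_on S (indicator_hat A)"
  unfolding indicator_hat_def by (intro continuous_intros)

text \<open>
The mean value property.  Cauchy's formula is stated for the positively oriented circle, while
\<open>zcirc\<close> runs clockwise; conjugating the function twice turns one orientation into the other.
\<close>
lemma has_integral_entire_zcirc:
  assumes "g holomorphic_on UNIV"
  shows "((\<lambda>\<theta>. g (zcirc \<theta>)) has_integral g 0) {0..1}"
proof -
  define h where "h = cnj \<circ> g \<circ> cnj"
  have "h holomorphic_on UNIV"
    unfolding h_def using holomorphic_on_compose_cnj_cnj[of g UNIV] assms by (simp add: holomorphic_on_subset)
  then have "((\<lambda>u. h u / (u - 0)) has_contour_integral 2 * of_real pi * \<i> * h 0) (circlepath 0 1)"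
    by (intro Cauchy_integral_circlepath_simple) (auto intro: holomorphic_on_subset)
  then have "((\<lambda>\<theta>. h (circlepath 0 1 \<theta>) / circlepath 0 1 \<theta>
        * vector_derivative (circlepath 0 1) (at \<theta> within {0..1}))
      has_integral 2 * of_real pi * \<i> * h 0) {0..1}"
    by (simp add: has_contour_integral_def)
  then have "((\<lambda>\<theta>. (2 * of_real pi * \<i>) * h (exp (2 * of_real pi * \<i> * of_real \<theta>)))
      has_integral 2 * of_real pi * \<i> * h 0) {0..1}"
    by (rule has_integral_eq [rotated]) (simp add: vector_derivative_circlepath01, simp add: circlepath)
  then have "((\<lambda>\<theta>. h (exp (2 * of_real pi * \<i> * of_real \<theta>))) has_integral h 0) {0..1}"
    by (subst (asm) has_integral_mult_right_iff) auto
  then have "((\<lambda>\<theta>. cnj (h (exp (2 * of_real pi * \<i> * of_real \<theta>)))) has_integral cnj (h 0)) {0..1}"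
    by (subst (asm) has_integral_cnj [symmetric]) (simp add: o_def)
  then show ?thesis
    by (simp add: h_def zcirc_def exp_cnj)
qed

lemma integral_entire_zcirc:
  "g holomorphic_on UNIV \<Longrightarrow> integral {0..1} (\<lambda>\<theta>. g (zcirc \<theta>)) = g 0"
  using has_integral_entire_zcirc integral_unique by blast

text \<open>
An entire function has no negative frequencies in \<open>z\<close>, and multiplying it by a positive power of \<open>z\<close>
also kills the constant term.  This is the only way in which one-sidedness of the spectrum is used.
\<close>
lemma integral_zcirc_powi_mult_entire:
  assumes "g holomorphic_on UNIV" "d > 0"
  shows "integral {0..1} (\<lambda>\<theta>. zcirc \<theta> powi d * g (zcirc \<theta>)) = 0"
proof -
  have "integral {0..1} (\<lambda>\<theta>. zcirc \<theta> ^ nat d * g (zcirc \<theta>)) = 0 ^ nat d * g 0"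
    using assms by (intro integral_entire_zcirc[of "\<lambda>z. z ^ nat d * g z"] holomorphic_intros)
  then show ?thesis
    using assms by (simp add: power_int_def)
qed

lemma integral_zcirc_powi:
  "integral {0..1} (\<lambda>\<theta>. zcirc \<theta> powi d) = (if d = 0 then 1 else 0)"
proof (cases d "0::int" rule: linorder_cases)
  case less
  have "integral {0..1} (\<lambda>\<theta>. cnj (zcirc \<theta> powi (- d))) = cnj (integral {0..1} (\<lambda>\<theta>. zcirc \<theta> powi (- d)))"
    by (simp add: integral_cnj)
  also have "integral {0..1} (\<lambda>\<theta>. zcirc \<theta> powi (- d)) = 0"
    using integral_zcirc_powi_mult_entire[of "\<lambda>_. 1" "- d"] less by simp
  finally show ?thesis using less by (simp only: cnj_zcirc_powi) simp
next
  case greater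
  then show ?thesis using integral_zcirc_powi_mult_entire[of "\<lambda>_. 1" d] by simp
qed simp

section \<open>Real functions as real parts of polynomials\<close>

lemma inverse_eq_cnj_on_circle: "norm z = 1 \<Longrightarrow> inverse z = cnj z"
  using complex_norm_square[of z] by (intro inverse_unique) simp

text \<open>
On the circle \<open>1 / z = cnj z\<close>, so the real part of a negative power of \<open>z\<close> is the real part of a
positive one.  Hence real parts of Laurent polynomials are real parts of polynomials.
\<close>
lemma Re_poly_divide_power_on_circle:
  "\<exists>s. \<forall>z. norm z = 1 \<longrightarrow> Re (poly r z / z ^ n) = Re (poly s z)"
proof (induction n arbitrary: r)
  case 0
  then show ?case by auto
next
  case (Suc n)
  obtain a r' where r: "r = pCons a r'" by (rule pCons_cases)
  obtain s where s: "\<And>z. norm z = 1 \<Longrightarrow> Re (poly r' z / z ^ n) = Re (poly s z)"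
    using Suc.IH by blast
  have "Re (poly r z / z ^ Suc n) = Re (poly (monom (cnj a) (Suc n) + s) z)" if z: "norm z = 1" for z
  proof -
    have "inverse z = cnj z"
      using z inverse_eq_cnj_on_circle by metis
    then have "a / z ^ Suc n = cnj (cnj a * z ^ Suc n)"
      by (simp add: divide_inverse power_inverse [symmetric])
    then have "Re (a / z ^ Suc n) = Re (cnj a * z ^ Suc n)"
      by (simp only: complex_cnj_cnj cnj.sel)
    moreover have "z \<noteq> 0" using z by auto
    then have "poly r z / z ^ Suc n = a / z ^ Suc n + poly r' z / z ^ n"
      by (simp add: r add_divide_distrib)
    ultimately show ?thesis
      using s[OF z] by (simp only: plus_complex.sel poly_add poly_monom)
  qed
  then show ?case by blast
qed

text \<open>
The division by \<open>z ^ n\<close> is there for the induction: peeling off the constant coefficient of \<open>q\<close>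
leaves a factor \<open>cnj z = 1 / z\<close>.
\<close>
lemma Re_poly_mult_cnj_poly_on_circle:
  "\<exists>s. \<forall>z. norm z = 1 \<longrightarrow> Re (poly p z * cnj (poly q z) / z ^ n) = Re (poly s z)"
proof (induction q arbitrary: n)
  case 0
  have "\<forall>z. norm z = 1 \<longrightarrow> Re (poly p z * cnj (poly 0 z) / z ^ n) = Re (poly 0 z)"
    by simp
  then show ?case by blast
next
  case (pCons a q)
  obtain s where s: "\<And>z. norm z = 1 \<Longrightarrow> Re (poly p z * cnj (poly q z) / z ^ Suc n) = Re (poly s z)"
    using pCons.IH by blast
  obtain t where t: "\<And>z. norm z = 1 \<Longrightarrow> Re (poly (smult (cnj a) p) z / z ^ n) = Re (poly t z)"
    using Re_poly_divide_power_on_circle by blast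
  have "Re (poly p z * cnj (poly (pCons a q) z) / z ^ n) = Re (poly (t + s) z)" if z: "norm z = 1" for z
  proof -
    have "cnj z = inverse z"
      using z inverse_eq_cnj_on_circle by metis
    then have "poly p z * cnj (poly (pCons a q) z) / z ^ n
        = poly (smult (cnj a) p) z / z ^ n + poly p z * cnj (poly q z) / z ^ Suc n"
      by (simp add: distrib_left add_divide_distrib mult_ac divide_inverse)
    then show ?thesis
      using s[OF z] t[OF z] by (simp only: plus_complex.sel poly_add)
  qed
  then show ?case by blast
qed

text \<open>
The multiplicative step is the point: \<open>Re s * Re t = Re (s * t + s * cnj t) / 2\<close>.
\<close>
lemma real_polynomial_function_on_circle:
  fixes g :: "complex \<Rightarrow> real"
  assumes "real_polynomial_function g"
  shows "\<exists>s. \<forall>z. norm z = 1 \<longrightarrow> g z = Re (poly s z)"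
  using assms
proof induction
  case (linear g)
  then interpret bounded_linear g .
  have "g z = Re (poly [:0, Complex (g 1) (- g \<i>):] z)" for z
  proof -
    have "z = Re z *\<^sub>R 1 + Im z *\<^sub>R \<i>"
      by (simp add: complex_eq_iff)
    then have "g z = Re z * g 1 + Im z * g \<i>"
      by (metis add scaleR real_scaleR_def)
    then show ?thesis by simp
  qed
  then show ?case by blast
next
  case (const c)
  have "\<forall>z. norm z = 1 \<longrightarrow> c = Re (poly [:of_real c:] z)" by simp
  then show ?case by blast
next
  case (add f g)
  then obtain s t where "\<And>z. norm z = 1 \<Longrightarrow> f z = Re (poly s z)" "\<And>z. norm z = 1 \<Longrightarrow> g z = Re (poly t z)"
    by blast
  then have "\<forall>z. norm z = 1 \<longrightarrow> f z + g z = Re (poly (s + t) z)" by simp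
  then show ?case by blast
next
  case (mult f g)
  then obtain s t where st: "\<And>z. norm z = 1 \<Longrightarrow> f z = Re (poly s z)" "\<And>z. norm z = 1 \<Longrightarrow> g z = Re (poly t z)"
    by blast
  obtain r where r: "\<And>z. norm z = 1 \<Longrightarrow> Re (poly s z * cnj (poly t z)) = Re (poly r z)"
    using Re_poly_mult_cnj_poly_on_circle[of s t 0] by auto
  have "f z * g z = Re (poly (smult (1/2) (s * t + r)) z)" if z: "norm z = 1" for z
    using r[OF z] by (simp add: st z)
  then show ?case by blast
qed

text \<open>
Stone--Weierstrass from above.  Every continuous real function on the circle is, up to a small
error, the real part of a holomorphic function whose value at \<open>0\<close> is real; this replaces the
conjugate function of Fourier analysis, and keeps all exponents below polynomials.
\<close>
lemma continuous_on_circle_approx_Re_poly: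
  fixes u :: "complex \<Rightarrow> real"
  assumes u: "continuous_on (sphere 0 1) u" and "\<epsilon> > 0"
  obtains s where "Im (poly s 0) = 0"
    "\<And>z. norm z = 1 \<Longrightarrow> u z \<le> Re (poly s z) \<and> Re (poly s z) \<le> u z + \<epsilon>"
proof -
  obtain g where g: "real_polynomial_function g"
      "\<And>z. z \<in> sphere 0 1 \<Longrightarrow> \<bar>(u z + \<epsilon> / 2) - g z\<bar> < \<epsilon> / 2"
    by (rule Stone_Weierstrass_real_polynomial_function[of "sphere 0 1" "\<lambda>z. u z + \<epsilon> / 2" "\<epsilon> / 2"])
      (use assms in \<open>auto intro!: continuous_intros\<close>)
  obtain s where s: "\<And>z. norm z = 1 \<Longrightarrow> g z = Re (poly s z)"
    using real_polynomial_function_on_circle[OF g(1)] by blast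
  show thesis
  proof (rule that[of "s - [:Complex 0 (Im (poly s 0)):]"])
    show "u z \<le> Re (poly (s - [:Complex 0 (Im (poly s 0)):]) z) \<and>
        Re (poly (s - [:Complex 0 (Im (poly s 0)):]) z) \<le> u z + \<epsilon>" if "norm z = 1" for z
      using g(2)[of z] s[OF that] that unfolding abs_less_iff by (simp add: field_simps; linarith)
  qed simp
qed

lemma integrable_on_01_continuous:
  fixes f :: "real \<Rightarrow> 'a::banach"
  shows "continuous_on {0..1} f \<Longrightarrow> f integrable_on {0..1}"
  by (simp add: integrable_continuous_interval)

lemma Re_integral:
  "f integrable_on A \<Longrightarrow> Re (integral A f) = integral A (\<lambda>x. Re (f x))"
  using integral_linear[OF _ bounded_linear_Re, of f A] by (simp add: o_def)

text \<open>
Passing from \<open>Re s\<close> to \<open>s\<close> costs only a factor 2 in mean square, because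
\<open>\<bar>s\<bar>\<^sup>2 = 2 * (Re s)\<^sup>2 - Re (s\<^sup>2)\<close> and the mean of \<open>s\<^sup>2\<close> is its value at \<open>0\<close>, the square of a real number.
\<close>
lemma integral_norm_poly_le:
  assumes "Im (poly s 0) = 0"
  shows "integral {0..1} (\<lambda>\<theta>. (norm (poly s (zcirc \<theta>)))\<^sup>2)
    \<le> 2 * integral {0..1} (\<lambda>\<theta>. (Re (poly s (zcirc \<theta>)))\<^sup>2)"
proof -
  have sq: "(norm w)\<^sup>2 = 2 * (Re w)\<^sup>2 - Re (w\<^sup>2)" for w
    unfolding cmod_power2 by (simp add: power2_eq_square)
  have "integral {0..1} (\<lambda>\<theta>. (norm (poly s (zcirc \<theta>)))\<^sup>2)
    = integral {0..1} (\<lambda>\<theta>. 2 * (Re (poly s (zcirc \<theta>)))\<^sup>2) - integral {0..1} (\<lambda>\<theta>. Re ((poly s (zcirc \<theta>))\<^sup>2))"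
    unfolding sq by (intro integral_diff integrable_on_01_continuous continuous_intros)
  also have "integral {0..1} (\<lambda>\<theta>. Re ((poly s (zcirc \<theta>))\<^sup>2)) = Re (integral {0..1} (\<lambda>\<theta>. (poly s (zcirc \<theta>))\<^sup>2))"
    by (intro Re_integral[symmetric] integrable_on_01_continuous continuous_intros)
  also have "integral {0..1} (\<lambda>\<theta>. (poly s (zcirc \<theta>))\<^sup>2) = (poly s 0)\<^sup>2"
    by (intro integral_entire_zcirc[of "\<lambda>z. (poly s z)\<^sup>2"] holomorphic_intros)
  finally show ?thesis
    using assms by (simp add: power2_eq_square)
qed

lemma norm_1_minus_exp_le:
  assumes "Re w \<ge> 0"
  shows "norm (1 - exp (- w)) \<le> norm w"
proof -
  have "norm (exp (- w) - exp 0) \<le> 1 * norm (- w - 0)"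
  proof (rule field_differentiable_bound[of "{z. Re z \<le> 0}" exp exp 1 ])
    show "(exp has_field_derivative exp z) (at z within {z. Re z \<le> 0})" for z :: complex
      using DERIV_exp has_field_derivative_at_within by blast
  qed (use assms in \<open>auto simp: convex_halfspace_Re_le\<close>)
  then show ?thesis by (simp add: norm_minus_commute)
qed

section \<open>Second and fourth moments\<close>

definition additive_energy :: "'a::ab_group_add set \<Rightarrow> nat" where
  "additive_energy B = card {(a, b, c, d). a \<in> B \<and> b \<in> B \<and> c \<in> B \<and> d \<in> B \<and> a - b = c - d}"

lemma integral_norm2_indicator_hat:
  assumes "finite B"
  shows "integral {0..1} (\<lambda>\<theta>. (norm (indicator_hat B \<theta>))\<^sup>2) = real (card B)"
proof -
  have "complex_of_real ((norm (indicator_hat B \<theta>))\<^sup>2) = (\<Sum>a\<in>B. \<Sum>b\<in>B. zcirc \<theta> powi (a - b))" for \<theta>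
    unfolding complex_norm_square indicator_hat_eq cnj_sum sum_product cnj_zcirc_powi
    by (simp add: power_int_add[symmetric] del: power_int_minus)
  then have "complex_of_real (integral {0..1} (\<lambda>\<theta>. (norm (indicator_hat B \<theta>))\<^sup>2))
      = integral {0..1} (\<lambda>\<theta>. \<Sum>a\<in>B. \<Sum>b\<in>B. zcirc \<theta> powi (a - b))"
    using integral_linear[OF _ bounded_linear_of_real[where 'a=complex], of "\<lambda>\<theta>. (norm (indicator_hat B \<theta>))\<^sup>2" "{0..1}"]
    by (simp add: o_def integrable_on_01_continuous continuous_intros)
  also have "\<dots> = (\<Sum>a\<in>B. \<Sum>b\<in>B. integral {0..1} (\<lambda>\<theta>. zcirc \<theta> powi (a - b)))"
    using assms
    by (simp add: integral_sum integrable_sum integrable_on_01_continuous continuous_intros)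
  also have "\<dots> = of_nat (card B)"
    using assms by (simp add: integral_zcirc_powi)
  finally show ?thesis
    by (simp only: of_real_eq_iff flip: of_real_of_nat_eq[where 'a = complex])
qed

lemma integral_norm4_indicator_hat:
  assumes "finite B"
  shows "integral {0..1} (\<lambda>\<theta>. (norm (indicator_hat B \<theta>)) ^ 4) = real (additive_energy B)"
proof -
  let ?Q = "B \<times> B \<times> B \<times> B"
  have "complex_of_real ((norm (indicator_hat B \<theta>)) ^ 4)
      = (\<Sum>(a, b, c, d)\<in>?Q. zcirc \<theta> powi (a - b - c + d))" for \<theta>
  proof -
    let ?f = "indicator_hat B \<theta>"
    have "complex_of_real ((norm ?f) ^ 4) = complex_of_real ((norm ?f)\<^sup>2) * complex_of_real ((norm ?f)\<^sup>2)"
      by (simp add: power_numeral_reduce)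
    also have "\<dots> = ?f * (cnj ?f * (cnj ?f * ?f))"
      unfolding complex_norm_square by (simp add: mult_ac)
    also have "\<dots> = (\<Sum>a\<in>B. \<Sum>b\<in>B. \<Sum>c\<in>B. \<Sum>d\<in>B. zcirc \<theta> powi (a - b - c + d))"
      unfolding indicator_hat_eq cnj_sum sum_product sum_distrib_left sum_distrib_right cnj_zcirc_powi
      by (simp add: power_int_add[symmetric] algebra_simps del: power_int_minus)
    finally show ?thesis
      by (simp add: sum.cartesian_product)
  qed
  then have "complex_of_real (integral {0..1} (\<lambda>\<theta>. (norm (indicator_hat B \<theta>)) ^ 4))
      = integral {0..1} (\<lambda>\<theta>. \<Sum>(a, b, c, d)\<in>?Q. zcirc \<theta> powi (a - b - c + d))"
    using integral_linear[OF _ bounded_linear_of_real[where 'a=complex], of "\<lambda>\<theta>. (norm (indicator_hat B \<theta>)) ^ 4" "{0..1}"]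
    by (simp add: o_def integrable_on_01_continuous continuous_intros)
  also have "\<dots> = (\<Sum>(a, b, c, d)\<in>?Q. integral {0..1} (\<lambda>\<theta>. zcirc \<theta> powi (a - b - c + d)))"
    using assms unfolding case_prod_beta
    by (subst integral_sum) (auto intro!: integrable_on_01_continuous continuous_intros)
  also have "\<dots> = of_nat (card {q \<in> ?Q. case q of (a, b, c, d) \<Rightarrow> a - b - c + d = 0})"
    using assms unfolding integral_zcirc_powi case_prod_beta
    by (subst sum.If_cases) (auto simp: Int_def)
  also have "{q \<in> ?Q. case q of (a, b, c, d) \<Rightarrow> a - b - c + d = 0}
      = {(a, b, c, d). a \<in> B \<and> b \<in> B \<and> c \<in> B \<and> d \<in> B \<and> a - b = c - d}"
    by auto
  finally show ?thesis
    by (simp only: additive_energy_def of_real_eq_iff flip: of_real_of_nat_eq[where 'a = complex])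
qed

section \<open>The dual function\<close>

text \<open>
Each summand is at most \<open>(1 - exp (- y k)) * exp (- (\<Sum>l\<in>{k<..<n}. y l))\<close>, since
\<open>1 + x k \<le> exp (y k)\<close>, and these bounds telescope.
\<close>
lemma sum_times_exp_tail_le:
  fixes x y :: "nat \<Rightarrow> real"
  assumes "m \<le> n" and "\<And>k. k \<in> {m..<n} \<Longrightarrow> 0 \<le> x k \<and> x k \<le> y k"
  shows "(\<Sum>k\<in>{m..<n}. x k * exp (- (\<Sum>l\<in>{k..<n}. y l))) \<le> 1 - exp (- (\<Sum>l\<in>{m..<n}. y l))"
  using assms
proof (induction n rule: dec_induct)
  case base
  then show ?case by simp
next
  case (step n)
  let ?E = "\<lambda>k. exp (- (\<Sum>l\<in>{k..<n}. y l))"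
  have split: "exp (- (\<Sum>l\<in>{k..<Suc n}. y l)) = ?E k * exp (- y n)" if "k \<le> n" for k
    using that by (simp add: exp_add[symmetric])
  have "(\<Sum>k\<in>{m..<Suc n}. x k * exp (- (\<Sum>l\<in>{k..<Suc n}. y l)))
      = (\<Sum>k\<in>{m..<n}. x k * ?E k) * exp (- y n) + x n * exp (- y n)"
    using step.hyps by (simp add: sum_distrib_right split mult.assoc del: sum.op_ivl_Suc)
      (simp add: split)
  also have "\<dots> \<le> (1 - ?E m) * exp (- y n) + x n * exp (- y n)"
    using step by (intro add_right_mono mult_right_mono step.IH) auto
  also have "\<dots> = (1 + x n) * exp (- y n) - ?E m * exp (- y n)"
    by (simp add: algebra_simps)
  also have "(1 + x n) * exp (- y n) \<le> exp (y n) * exp (- y n)"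
  proof (intro mult_right_mono)
    have "x n \<le> y n" using step by auto
    then show "1 + x n \<le> exp (y n)" using exp_ge_add_one_self[of "y n"] by linarith
  qed simp
  finally show ?case
    using step.hyps by (simp add: split mult_exp_exp)
qed

lemma geometric_tail_le:
  fixes k n :: nat
  shows "(\<Sum>l\<in>{k..<n}. 1 / 2 ^ l) \<le> 2 / (2 ^ k :: real)"
proof -
  have "k \<le> n \<Longrightarrow> (\<Sum>l\<in>{k..<n}. 1 / 2 ^ l) \<le> 2 / (2 ^ k :: real) - 2 / 2 ^ n"
  proof (induction n rule: dec_induct)
    case (step n)
    have "2 / (2::real) ^ Suc n = 1 / 2 ^ n" "2 / (2::real) ^ n = 1 / 2 ^ n + 1 / 2 ^ n" by simp_all
    moreover have "(\<Sum>l\<in>{k..<Suc n}. 1 / (2::real) ^ l) = (\<Sum>l\<in>{k..<n}. 1 / 2 ^ l) + 1 / 2 ^ n"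
      using step.hyps by simp
    ultimately show ?case using step.IH by linarith
  qed simp
  moreover have "2 / (2 ^ k :: real) - 2 / 2 ^ n \<le> 2 / 2 ^ k" by simp
  ultimately show ?thesis
    by (cases "k \<le> n") (auto intro: order_trans)
qed

text \<open>
The dual function.  Let \<open>f k\<close> be the transform of \<open>B k\<close>, scaled by \<open>lam k = \<Lambda> * 4 ^ k\<close> with \<open>\<Lambda> = 12 * sqrt \<delta>\<close>,
and let \<open>w k\<close> be a polynomial in \<open>z\<close> whose real part slightly exceeds \<open>\<bar>f k\<bar> / lam k\<close>.  The test function is
\<open>\<Sum>k. cnj (f k) / lam k * exp (- (\<Sum>l\<ge>k. w l))\<close>.

It is bounded by 1 because every summand is damped by its own size and by that of all later ones.
Since \<open>w\<close> is a polynomial in \<open>z\<close>, the \<open>k\<close>-th summand has no correlation with elements of \<open>A\<close>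
beyond \<open>B k\<close>, so pairing it with the transform of \<open>A\<close> gives the integral of
\<open>\<bar>f k\<bar>\<^sup>2 / lam k\<close> times the damping factor.  Without damping that is \<open>4 ^ k / lam k = 1 / \<Lambda>\<close>.  The
damping loses at most half of this: \<open>\<bar>1 - exp (- w)\<bar> \<le> \<bar>w\<bar>\<close>, and by Cauchy--Schwarz the loss due to \<open>w l\<close>
is at most the square root of the energy of \<open>B k\<close> times the quadratic norm of \<open>w l\<close>, which decays like
\<open>2 ^ (- l)\<close>.  So each of the scales contributes \<open>1 / (2 * \<Lambda>)\<close> to the norm.  The case
\<open>\<delta> = 1\<close> is the Littlewood lower bound of McGehee, Pigno, Smith and Konyagin.
\<close>
theorem L1_norm_ge_of_low_energy_initial_segments:
  fixes A :: "int set" and B :: "nat \<Rightarrow> int set" and \<delta> :: real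
  assumes A: "finite A" and \<delta>: "\<delta> > 0"
    and sub: "\<And>k. k \<in> {m..<n} \<Longrightarrow> B k \<subseteq> A"
    and initial: "\<And>k a b. \<lbrakk>k \<in> {m..<n}; b \<in> B k; a \<in> A - B k\<rbrakk> \<Longrightarrow> b < a"
    and card: "\<And>k. k \<in> {m..<n} \<Longrightarrow> card (B k) = 4 ^ k"
    and energy: "\<And>k. k \<in> {m..<n} \<Longrightarrow> real (additive_energy (B k)) \<le> \<delta> * (4 ^ k) ^ 3"
  shows "real (n - m) / (24 * sqrt \<delta>) \<le> indicator_hat_L1 A"
proof -
  define \<Lambda> where "\<Lambda> = 12 * sqrt \<delta>"
  have \<Lambda>: "\<Lambda> > 0" "\<Lambda>\<^sup>2 = 144 * \<delta>"
    using \<delta> by (auto simp: \<Lambda>_def power_mult_distrib)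
  define lam where "lam k = \<Lambda> * 4 ^ k" for k :: nat
  have lam: "lam k > 0" for k using \<Lambda> by (simp add: lam_def)
  define f where "f k = indicator_hat (B k)" for k
  \<comment> \<open>the root mean square of \<open>norm (f k \<theta>) / lam k\<close>, so that the approximation error is of no larger order\<close>
  define eps where "eps k = 1 / (\<Lambda> * 2 ^ k)" for k :: nat
  have eps: "eps k > 0" for k using \<Lambda> by (simp add: eps_def)
  have "\<exists>s. Im (poly s 0) = 0 \<and> (\<forall>z. norm z = 1 \<longrightarrow>
      norm (\<Sum>n\<in>B k. z powi n) / lam k \<le> Re (poly s z) \<and>
      Re (poly s z) \<le> norm (\<Sum>n\<in>B k. z powi n) / lam k + eps k)" for k
  proof -
    have "continuous_on (sphere 0 1) (\<lambda>z::complex. norm (\<Sum>n\<in>B k. z powi n) / lam k)"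
      using lam[of k] by (intro continuous_intros) auto
    from continuous_on_circle_approx_Re_poly[OF this eps] show ?thesis by metis
  qed
  then obtain s where s: "\<And>k. Im (poly (s k) 0) = 0"
      "\<And>k z. norm z = 1 \<Longrightarrow> norm (\<Sum>n\<in>B k. z powi n) / lam k \<le> Re (poly (s k) z)"
      "\<And>k z. norm z = 1 \<Longrightarrow> Re (poly (s k) z) \<le> norm (\<Sum>n\<in>B k. z powi n) / lam k + eps k"
    by metis
  define w where "w k \<theta> = poly (s k) (zcirc \<theta>)" for k \<theta>
  have w_lower: "norm (f k \<theta>) / lam k \<le> Re (w k \<theta>)"
    and w_upper: "Re (w k \<theta>) \<le> norm (f k \<theta>) / lam k + eps k" for k \<theta>
    using s(2,3)[of "zcirc \<theta>" k] by (auto simp: f_def w_def indicator_hat_eq)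
  have w_nonneg: "Re (w k \<theta>) \<ge> 0" for k \<theta>
    using w_lower[of k \<theta>] lam[of k] by (auto intro: order_trans[rotated])
  have cont_f [continuous_intros]: "continuous_on {0..1} (f k)" for k
    unfolding f_def by (intro continuous_intros)
  have cont_w [continuous_intros]: "continuous_on {0..1} (w k)" for k
    unfolding w_def by (intro continuous_intros)
  have fin: "finite (B k)" if "k \<in> {m..<n}" for k
    using sub[OF that] A finite_subset by blast

  have w_L2: "integral {0..1} (\<lambda>\<theta>. (norm (w k \<theta>))\<^sup>2) \<le> 8 / (\<Lambda>\<^sup>2 * 4 ^ k)" if k: "k \<in> {m..<n}" for k
  proof -
    have "integral {0..1} (\<lambda>\<theta>. (norm (w k \<theta>))\<^sup>2) \<le> 2 * integral {0..1} (\<lambda>\<theta>. (Re (w k \<theta>))\<^sup>2)"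
      unfolding w_def by (rule integral_norm_poly_le) (rule s(1))
    also have "integral {0..1} (\<lambda>\<theta>. (Re (w k \<theta>))\<^sup>2)
        \<le> integral {0..1} (\<lambda>\<theta>. 2 / (lam k)\<^sup>2 * (norm (f k \<theta>))\<^sup>2 + 2 * (eps k)\<^sup>2)"
    proof (intro integral_le integrable_on_01_continuous continuous_intros)
      fix \<theta> :: real
      have "(Re (w k \<theta>))\<^sup>2 \<le> (norm (f k \<theta>) / lam k + eps k)\<^sup>2"
        using w_nonneg w_upper by (intro power_mono)
      also have "\<dots> \<le> 2 * (norm (f k \<theta>) / lam k)\<^sup>2 + 2 * (eps k)\<^sup>2"
        using sum_squares_bound[of "norm (f k \<theta>) / lam k" "eps k"] by (simp add: power2_sum)
      finally show "(Re (w k \<theta>))\<^sup>2 \<le> 2 / (lam k)\<^sup>2 * (norm (f k \<theta>))\<^sup>2 + 2 * (eps k)\<^sup>2"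
        by (simp add: power_divide)
    qed
    also have "\<dots> = 2 / (lam k)\<^sup>2 * 4 ^ k + 2 * (eps k)\<^sup>2"
    proof -
      have "integral {0..1} (\<lambda>\<theta>. 2 / (lam k)\<^sup>2 * (norm (f k \<theta>))\<^sup>2 + 2 * (eps k)\<^sup>2)
          = integral {0..1} (\<lambda>\<theta>. 2 / (lam k)\<^sup>2 * (norm (f k \<theta>))\<^sup>2) + integral {0..1} (\<lambda>\<theta>::real. 2 * (eps k)\<^sup>2)"
        by (intro integral_add integrable_on_01_continuous continuous_intros)
      then show ?thesis
        using integral_norm2_indicator_hat[OF fin[OF k]] card[OF k]
        by (simp add: f_def)
    qed
    also have "2 * (2 / (lam k)\<^sup>2 * 4 ^ k + 2 * (eps k)\<^sup>2) = 8 / (\<Lambda>\<^sup>2 * 4 ^ k)"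
    proof -
      have "(4::real) ^ k = 2 ^ k * 2 ^ k" by (simp flip: power_mult_distrib)
      then show ?thesis
        using \<Lambda>(1) by (simp add: lam_def eps_def power2_eq_square field_simps)
    qed
    finally show ?thesis by simp
  qed

  have cross: "integral {0..1} (\<lambda>\<theta>. (norm (f k \<theta>))\<^sup>2 * norm (w l \<theta>)) \<le> 8 ^ k / 4 * (1 / 2 ^ l)"
    if k: "k \<in> {m..<n}" and l: "l \<in> {m..<n}" for k l
  proof -
    \<comment> \<open>Cauchy--Schwarz in the form \<open>2 * a * b \<le> t * a\<^sup>2 + b\<^sup>2 / t\<close>, with a nearly optimal \<open>t\<close>\<close>
    define t where "t = 1 / (4 * \<delta> * 2 ^ l * 8 ^ k)"
    have t: "t > 0" using \<delta> by (simp add: t_def)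
    have "integral {0..1} (\<lambda>\<theta>. (norm (f k \<theta>))\<^sup>2 * norm (w l \<theta>))
        \<le> integral {0..1} (\<lambda>\<theta>. t / 2 * (norm (f k \<theta>)) ^ 4 + 1 / (2 * t) * (norm (w l \<theta>))\<^sup>2)"
    proof (intro integral_le integrable_on_01_continuous continuous_intros)
      fix \<theta> :: real
      let ?a = "(norm (f k \<theta>))\<^sup>2" and ?b = "norm (w l \<theta>)"
      have "0 \<le> (t * ?a - ?b)\<^sup>2 / (2 * t)" using t by simp
      also have "\<dots> = t / 2 * ?a\<^sup>2 + 1 / (2 * t) * ?b\<^sup>2 - ?a * ?b"
        using t by (simp add: power2_eq_square field_simps)
      finally show "?a * ?b \<le> t / 2 * (norm (f k \<theta>)) ^ 4 + 1 / (2 * t) * ?b\<^sup>2"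
        by simp
    qed
    also have "\<dots> = t / 2 * integral {0..1} (\<lambda>\<theta>. (norm (f k \<theta>)) ^ 4)
        + 1 / (2 * t) * integral {0..1} (\<lambda>\<theta>. (norm (w l \<theta>))\<^sup>2)"
    proof -
      have "integral {0..1} (\<lambda>\<theta>. t / 2 * (norm (f k \<theta>)) ^ 4 + 1 / (2 * t) * (norm (w l \<theta>))\<^sup>2)
         = integral {0..1} (\<lambda>\<theta>. t / 2 * (norm (f k \<theta>)) ^ 4) + integral {0..1} (\<lambda>\<theta>. 1 / (2 * t) * (norm (w l \<theta>))\<^sup>2)"
        by (intro integral_add integrable_on_01_continuous continuous_intros)
      then show ?thesis by (simp only: integral_mult_right)
    qed
    also have "\<dots> \<le> t / 2 * (\<delta> * (4 ^ k) ^ 3) + 1 / (2 * t) * (8 / (\<Lambda>\<^sup>2 * 4 ^ l))"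
      using t energy[OF k] w_L2[OF l] integral_norm4_indicator_hat[OF fin[OF k]]
      by (intro add_mono mult_left_mono) (auto simp: f_def)
    also have "t / 2 * (\<delta> * (4 ^ k) ^ 3) = 8 ^ k / 8 * (1 / 2 ^ l)"
    proof -
      have "((4::real) ^ k) ^ 3 = 8 ^ k * 8 ^ k"
        by (simp add: power_mult[symmetric] mult.commute[of k] flip: power_mult_distrib)
           (simp add: power_mult)
      then show ?thesis using \<delta> by (simp add: t_def field_simps)
    qed
    also have "1 / (2 * t) * (8 / (\<Lambda>\<^sup>2 * 4 ^ l)) = 8 ^ k / 9 * (1 / 2 ^ l)"
    proof -
      have "(4::real) ^ l = 2 ^ l * 2 ^ l"
        by (simp flip: power_mult_distrib)
      then show ?thesis using \<delta> by (simp add: t_def \<Lambda>(2) field_simps)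
    qed
    also have "8 ^ k / 8 * (1 / 2 ^ l) + 8 ^ k / 9 * (1 / 2 ^ l) \<le> 8 ^ k / 4 * (1 / (2::real) ^ l)"
      by (simp add: field_simps)
    finally show ?thesis by simp
  qed

  define H where "H k \<theta> = (\<Sum>l\<in>{k..<n}. w l \<theta>)" for k \<theta>
  define G where "G k \<theta> = cnj (f k \<theta>) / lam k * exp (- H k \<theta>)" for k \<theta>
  have cont_H [continuous_intros]: "continuous_on {0..1} (H k)" for k
    unfolding H_def by (intro continuous_intros)
  have cont_G [continuous_intros]: "continuous_on {0..1} (G k)" for k
    unfolding G_def using lam[of k] by (intro continuous_intros) auto
  have Re_H: "Re (H k \<theta>) \<ge> 0" for k \<theta>
    unfolding H_def Re_sum by (intro sum_nonneg w_nonneg)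

  have pairing: "1 / (24 * sqrt \<delta>) \<le> Re (integral {0..1} (\<lambda>\<theta>. indicator_hat A \<theta> * G k \<theta>))"
    if k: "k \<in> {m..<n}" for k
  proof -
    \<comment> \<open>the elements of \<open>A\<close> beyond \<open>B k\<close> give only positive frequencies \<open>a - b\<close>, which average to zero\<close>
    have "integral {0..1} (\<lambda>\<theta>. (indicator_hat A \<theta> - f k \<theta>) * G k \<theta>)
        = integral {0..1} (\<lambda>\<theta>. \<Sum>a\<in>A - B k. \<Sum>b\<in>B k. zcirc \<theta> powi (a - b) * (exp (- H k \<theta>) / lam k))"
    proof (intro arg_cong[of _ _ "integral _"] ext)
      fix \<theta>
      have "indicator_hat A \<theta> - f k \<theta> = (\<Sum>a\<in>A - B k. zcirc \<theta> powi a)"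
        using A sub[OF k] by (simp add: f_def indicator_hat_eq sum_diff)
      then show "(indicator_hat A \<theta> - f k \<theta>) * G k \<theta>
          = (\<Sum>a\<in>A - B k. \<Sum>b\<in>B k. zcirc \<theta> powi (a - b) * (exp (- H k \<theta>) / lam k))"
        by (simp add: G_def f_def indicator_hat_eq cnj_sum cnj_zcirc_powi sum_product
            sum_distrib_right sum_distrib_left sum_divide_distrib power_int_diff power_int_minus field_simps
            del: complex_cnj_power_int) (rule sum.swap)
    qed
    also have "\<dots> = (\<Sum>a\<in>A - B k. \<Sum>b\<in>B k.
        integral {0..1} (\<lambda>\<theta>. zcirc \<theta> powi (a - b) * (exp (- H k \<theta>) / lam k)))"
      using A fin[OF k] lam[of k]
      by (simp add: integral_sum integrable_sum integrable_on_01_continuous continuous_intros)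
    also have "\<dots> = 0"
    proof (intro sum.neutral ballI)
      fix a b assume ab: "a \<in> A - B k" "b \<in> B k"
      have "integral {0..1} (\<lambda>\<theta>. zcirc \<theta> powi (a - b) *
          (exp (- (\<Sum>l\<in>{k..<n}. poly (s l) (zcirc \<theta>))) / complex_of_real (lam k))) = 0"
        using initial[OF k ab(2,1)] lam[of k]
        by (intro integral_zcirc_powi_mult_entire[of "\<lambda>z. exp (- (\<Sum>l\<in>{k..<n}. poly (s l) z)) / complex_of_real (lam k)"]
            holomorphic_intros) auto
      then show "integral {0..1} (\<lambda>\<theta>. zcirc \<theta> powi (a - b) * (exp (- H k \<theta>) / lam k)) = 0"
        by (simp add: H_def w_def)
    qed
    finally have zero: "integral {0..1} (\<lambda>\<theta>. (indicator_hat A \<theta> - f k \<theta>) * G k \<theta>) = 0" .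
    have "integral {0..1} (\<lambda>\<theta>. indicator_hat A \<theta> * G k \<theta>)
        = integral {0..1} (\<lambda>\<theta>. (indicator_hat A \<theta> - f k \<theta>) * G k \<theta>) + integral {0..1} (\<lambda>\<theta>. f k \<theta> * G k \<theta>)"
      by (subst integral_add [symmetric])
        (auto intro!: integrable_on_01_continuous continuous_intros simp: algebra_simps)
    then have "Re (integral {0..1} (\<lambda>\<theta>. indicator_hat A \<theta> * G k \<theta>))
        = integral {0..1} (\<lambda>\<theta>. Re (f k \<theta> * G k \<theta>))"
      by (simp add: zero Re_integral integrable_on_01_continuous continuous_intros)
    also have "\<dots> \<ge> integral {0..1} (\<lambda>\<theta>. 1 / lam k *
        ((norm (f k \<theta>))\<^sup>2 - (\<Sum>l\<in>{k..<n}. (norm (f k \<theta>))\<^sup>2 * norm (w l \<theta>))))"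
    proof (intro integral_le integrable_on_01_continuous continuous_intros)
      fix \<theta> :: real
      let ?F = "(norm (f k \<theta>))\<^sup>2"
      have "1 - Re (exp (- H k \<theta>)) \<le> norm (1 - exp (- H k \<theta>))"
        using complex_Re_le_cmod[of "1 - exp (- H k \<theta>)"] by simp
      also have "\<dots> \<le> norm (H k \<theta>)"
        by (rule norm_1_minus_exp_le) (rule Re_H)
      also have "\<dots> \<le> (\<Sum>l\<in>{k..<n}. norm (w l \<theta>))"
        unfolding H_def by (rule norm_sum)
      finally have "?F * (1 - (\<Sum>l\<in>{k..<n}. norm (w l \<theta>))) \<le> ?F * Re (exp (- H k \<theta>))"
        by (intro mult_left_mono) auto
      then have "1 / lam k * (?F * (1 - (\<Sum>l\<in>{k..<n}. norm (w l \<theta>)))) \<le> 1 / lam k * (?F * Re (exp (- H k \<theta>)))"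
        by (rule mult_left_mono) (use lam[of k] in simp)
      also have "1 / lam k * (?F * Re (exp (- H k \<theta>))) = Re (of_real (1 / lam k * ?F) * exp (- H k \<theta>))"
        by (simp only: Re_complex_of_real Im_complex_of_real times_complex.sel)
      also have "of_real (1 / lam k * ?F) * exp (- H k \<theta>) = f k \<theta> * G k \<theta>"
        by (simp add: G_def complex_norm_square del: of_real_power)
      finally show "1 / lam k * (?F - (\<Sum>l\<in>{k..<n}. ?F * norm (w l \<theta>))) \<le> Re (f k \<theta> * G k \<theta>)"
        by (simp add: algebra_simps sum_distrib_left)
    qed
    also have "integral {0..1} (\<lambda>\<theta>. 1 / lam k *
        ((norm (f k \<theta>))\<^sup>2 - (\<Sum>l\<in>{k..<n}. (norm (f k \<theta>))\<^sup>2 * norm (w l \<theta>))))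
      = 1 / lam k * (4 ^ k - (\<Sum>l\<in>{k..<n}. integral {0..1} (\<lambda>\<theta>. (norm (f k \<theta>))\<^sup>2 * norm (w l \<theta>))))"
    proof -
      have "integral {0..1} (\<lambda>\<theta>. (norm (f k \<theta>))\<^sup>2 - (\<Sum>l\<in>{k..<n}. (norm (f k \<theta>))\<^sup>2 * norm (w l \<theta>)))
        = integral {0..1} (\<lambda>\<theta>. (norm (f k \<theta>))\<^sup>2) - integral {0..1} (\<lambda>\<theta>. \<Sum>l\<in>{k..<n}. (norm (f k \<theta>))\<^sup>2 * norm (w l \<theta>))"
        by (intro integral_diff integrable_on_01_continuous continuous_intros)
      also have "integral {0..1} (\<lambda>\<theta>. \<Sum>l\<in>{k..<n}. (norm (f k \<theta>))\<^sup>2 * norm (w l \<theta>))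
        = (\<Sum>l\<in>{k..<n}. integral {0..1} (\<lambda>\<theta>. (norm (f k \<theta>))\<^sup>2 * norm (w l \<theta>)))"
        by (intro integral_sum integrable_on_01_continuous continuous_intros) auto
      also have "integral {0..1} (\<lambda>\<theta>. (norm (f k \<theta>))\<^sup>2) = 4 ^ k"
        using integral_norm2_indicator_hat[OF fin[OF k]] card[OF k] by (simp add: f_def)
      finally show ?thesis by (simp only: integral_mult_right)
    qed
    finally have lower: "1 / lam k * (4 ^ k - (\<Sum>l\<in>{k..<n}. integral {0..1} (\<lambda>\<theta>. (norm (f k \<theta>))\<^sup>2 * norm (w l \<theta>))))
        \<le> Re (integral {0..1} (\<lambda>\<theta>. indicator_hat A \<theta> * G k \<theta>))" .
    have tail: "(\<Sum>l\<in>{k..<n}. integral {0..1} (\<lambda>\<theta>. (norm (f k \<theta>))\<^sup>2 * norm (w l \<theta>))) \<le> 4 ^ k / 2"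
    proof -
      have "(\<Sum>l\<in>{k..<n}. integral {0..1} (\<lambda>\<theta>. (norm (f k \<theta>))\<^sup>2 * norm (w l \<theta>)))
          \<le> (\<Sum>l\<in>{k..<n}. 8 ^ k / 4 * (1 / 2 ^ l))"
        using k by (intro sum_mono cross) auto
      also have "\<dots> \<le> 8 ^ k / 4 * (2 / 2 ^ k)"
        unfolding sum_distrib_left[symmetric] by (intro mult_left_mono geometric_tail_le) auto
      also have "\<dots> = 4 ^ k / 2"
      proof -
        have "(8::real) ^ k = 4 ^ k * 2 ^ k" by (simp flip: power_mult_distrib)
        then show ?thesis by simp
      qed
      finally show ?thesis .
    qed
    have "1 / (24 * sqrt \<delta>) = 1 / lam k * (4 ^ k / 2)"
      using \<delta> by (simp add: lam_def \<Lambda>_def)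
    also have "\<dots> \<le> 1 / lam k * (4 ^ k - (\<Sum>l\<in>{k..<n}. integral {0..1} (\<lambda>\<theta>. (norm (f k \<theta>))\<^sup>2 * norm (w l \<theta>))))"
      using tail lam[of k] by (intro mult_left_mono) auto
    also note lower
    finally show ?thesis .
  qed

  have G_le: "norm (\<Sum>k\<in>{m..<n}. G k \<theta>) \<le> 1" for \<theta>
  proof (cases "m \<le> n")
    case True
    have "norm (\<Sum>k\<in>{m..<n}. G k \<theta>) \<le> (\<Sum>k\<in>{m..<n}. norm (G k \<theta>))"
      by (rule norm_sum)
    also have "\<dots> = (\<Sum>k\<in>{m..<n}. (norm (f k \<theta>) / lam k) * exp (- (\<Sum>l\<in>{k..<n}. Re (w l \<theta>))))"
      using lam by (intro sum.cong refl) (simp add: G_def H_def norm_mult norm_divide norm_exp_eq_Re abs_of_pos)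
    also have "\<dots> \<le> 1 - exp (- (\<Sum>l\<in>{m..<n}. Re (w l \<theta>)))"
      using True w_lower lam by (intro sum_times_exp_tail_le) (auto simp: less_imp_le)
    also have "\<dots> \<le> 1" by simp
    finally show ?thesis .
  qed simp

  have "real (n - m) / (24 * sqrt \<delta>) = (\<Sum>k\<in>{m..<n}. 1 / (24 * sqrt \<delta>))"
    by simp
  also have "\<dots> \<le> (\<Sum>k\<in>{m..<n}. Re (integral {0..1} (\<lambda>\<theta>. indicator_hat A \<theta> * G k \<theta>)))"
    by (intro sum_mono pairing)
  also have "\<dots> = Re (integral {0..1} (\<lambda>\<theta>. \<Sum>k\<in>{m..<n}. indicator_hat A \<theta> * G k \<theta>))"
    by (subst integral_sum) (auto intro!: integrable_on_01_continuous continuous_intros)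
  also have "\<dots> = Re (integral {0..1} (\<lambda>\<theta>. indicator_hat A \<theta> * (\<Sum>k\<in>{m..<n}. G k \<theta>)))"
    by (simp add: sum_distrib_left)
  also have "\<dots> \<le> norm (integral {0..1} (\<lambda>\<theta>. indicator_hat A \<theta> * (\<Sum>k\<in>{m..<n}. G k \<theta>)))"
    by (rule complex_Re_le_cmod)
  also have "\<dots> \<le> integral {0..1} (\<lambda>\<theta>. norm (indicator_hat A \<theta>))"
  proof (intro integral_norm_bound_integral integrable_on_01_continuous continuous_intros)
    fix \<theta> :: real
    show "norm (indicator_hat A \<theta> * (\<Sum>k\<in>{m..<n}. G k \<theta>)) \<le> norm (indicator_hat A \<theta>)"
      using mult_left_mono[OF G_le norm_ge_zero[of "indicator_hat A \<theta>"], of \<theta>] by (simp add: norm_mult)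
  qed
  finally show ?thesis by (simp add: indicator_hat_L1_def)
qed

section \<open>Sumset inequalities\<close>

text \<open>
Petridis' argument: add the elements \<open>c\<close> of \<open>C\<close> one at a time.  The part \<open>X0 + B + c\<close> of the new
translate \<open>X + B + c\<close> is already covered, and minimality of the ratio bounds \<open>X0 + B\<close> from below by
\<open>K * card X0\<close>; on the other side the new translate \<open>X + c\<close> loses to \<open>X + C\<close> only elements of \<open>X1 + c\<close>,
and \<open>X1 \<subseteq> X0\<close>.
\<close>
lemma petridis:
  fixes X B C :: "'a::ab_group_add set" and K :: real
  assumes X: "finite X" and B: "finite B" and C: "finite C" and K: "K \<ge> 0"
    and ratio: "real (card (X + B)) \<le> K * real (card X)"
    and minimal: "\<And>Z. Z \<subseteq> X \<Longrightarrow> K * real (card Z) \<le> real (card (Z + B))"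
  shows "real (card (X + B + C)) \<le> K * real (card (X + C))"
  using C
proof (induction C rule: finite_induct)
  case empty
  then show ?case by simp
next
  case (insert c C)
  have fXB: "finite (X + B)" and fXBC: "finite (X + B + C)" and fXC: "finite (X + C)"
    using X B insert.hyps by (auto intro: finite_set_plus)
  define X0 where "X0 = {x \<in> X. \<forall>b\<in>B. x + b + c \<in> X + B + C}"
  define X1 where "X1 = {x \<in> X. x + c \<in> X + C}"
  have "X1 \<subseteq> X0"
  proof
    fix x assume "x \<in> X1"
    then obtain x' c' where x: "x \<in> X" "x' \<in> X" "c' \<in> C" "x + c = x' + c'"
      unfolding X1_def by (auto elim!: set_plus_elim)
    have "x + b + c \<in> X + B + C" if "b \<in> B" for b
    proof -
      have "x + b + c = x' + b + c'" using x(4) by (metis add.assoc add.commute)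
      moreover have "x' + b + c' \<in> X + B + C"
        using x that by (intro set_plus_intro)
      ultimately show ?thesis by metis
    qed
    then show "x \<in> X0" using x by (auto simp: X0_def)
  qed
  have sub: "X0 \<subseteq> X" "X1 \<subseteq> X" by (auto simp: X0_def X1_def)
  have fX0: "finite X0" "finite X1" using sub X finite_subset by blast+
  have X0B: "X0 + B \<subseteq> X + B" using sub by (intro set_plus_mono2) auto

  let ?T = "(+) c ` (X + B - (X0 + B))"
  have "X + B + insert c C \<subseteq> (X + B + C) \<union> ?T"
  proof
    fix y assume "y \<in> X + B + insert c C"
    then obtain z d where y: "y = z + d" "z \<in> X + B" "d \<in> insert c C"
      by (auto elim!: set_plus_elim)
    show "y \<in> (X + B + C) \<union> ?T"
    proof (cases "d = c \<and> z \<notin> X0 + B")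
      case True
      then show ?thesis using y by (auto simp: add.commute)
    next
      case False
      then consider "d \<in> C" | "d = c" "z \<in> X0 + B" using y by auto
      then show ?thesis
      proof cases
        case 1 then show ?thesis using y by auto
      next
        case 2
        then obtain x b where "x \<in> X0" "b \<in> B" "z = x + b" by (auto elim!: set_plus_elim)
        then show ?thesis using 2 y by (auto simp: X0_def)
      qed
    qed
  qed
  then have "card (X + B + insert c C) \<le> card ((X + B + C) \<union> ?T)"
    using fXB fXBC by (intro card_mono) auto
  also have "\<dots> \<le> card (X + B + C) + card ?T"
    by (rule card_Un_le)
  also have "card ?T = card (X + B) - card (X0 + B)"
    using X0B fX0 B by (subst card_image) (auto intro: card_Diff_subset finite_set_plus)
  finally have upper: "real (card (X + B + insert c C)) + real (card (X0 + B)) \<le> real (card (X + B + C)) + real (card (X + B))"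
    using card_mono[OF fXB X0B] by linarith

  have "(X + C) \<union> (+) c ` (X - X1) \<subseteq> X + insert c C"
  proof (rule Un_least)
    show "X + C \<subseteq> X + insert c C" by (intro set_plus_mono2) auto
    show "(+) c ` (X - X1) \<subseteq> X + insert c C" by (auto simp: add.commute[of c])
  qed
  moreover have "(X + C) \<inter> (+) c ` (X - X1) = {}"
    by (auto simp: X1_def add.commute[of c])
  ultimately have "card (X + C) + card ((+) c ` (X - X1)) \<le> card (X + insert c C)"
    using X fXC insert.hyps
    by (subst card_Un_disjoint[symmetric]) (auto intro!: card_mono finite_set_plus)
  moreover have "card ((+) c ` (X - X1)) = card X - card X1"
    using sub fX0 by (subst card_image) (auto intro: card_Diff_subset)
  ultimately have lower: "real (card (X + C)) + real (card X) - real (card X0) \<le> real (card (X + insert c C))"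
    using card_mono[OF fX0(1) \<open>X1 \<subseteq> X0\<close>] card_mono[OF X sub(2)] by linarith

  have "real (card (X + B + insert c C)) \<le> K * real (card (X + C)) + K * real (card X) - K * real (card X0)"
    using upper insert.IH ratio minimal[OF sub(1)] by linarith
  also have "\<dots> = K * (real (card (X + C)) + real (card X) - real (card X0))"
    by (simp add: algebra_simps)
  also have "\<dots> \<le> K * real (card (X + insert c C))"
    using lower K by (intro mult_left_mono)
  finally show ?case .
qed

definition iterated_sumset :: "nat \<Rightarrow> 'a::comm_monoid_add set \<Rightarrow> 'a set" where
  "iterated_sumset n B = ((+) B ^^ n) {0}"

lemma iterated_sumset_0 [simp]: "iterated_sumset 0 B = {0}"
  and iterated_sumset_Suc: "iterated_sumset (Suc n) B = B + iterated_sumset n B"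
  by (simp_all add: iterated_sumset_def)

lemma finite_iterated_sumset: "finite B \<Longrightarrow> finite (iterated_sumset n B)"
  by (induction n) (auto simp: iterated_sumset_Suc intro: finite_set_plus)

text \<open>
The subset \<open>X\<close> of \<open>B\<close> with the smallest growth \<open>card (X + C) / card X\<close> satisfies the hypotheses of
\<open>petridis\<close>, which can then be iterated.
\<close>
lemma plunnecke_petridis:
  fixes B C :: "'a::ab_group_add set" and K :: real
  assumes B: "finite B" "B \<noteq> {}" and C: "finite C"
    and small: "real (card (B + C)) \<le> K * real (card B)"
  obtains X where "X \<subseteq> B" "X \<noteq> {}"
    "\<And>n. real (card (X + iterated_sumset n C)) \<le> K ^ n * real (card X)"
proof -
  define ratio where "ratio Z = real (card (Z + C)) / real (card Z)" for Z
  define S where "S = Pow B - {{}}"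
  have S: "finite S" "B \<in> S" using B by (auto simp: S_def)
  obtain X where X: "X \<in> S" "ratio X = Min (ratio ` S)"
    using Min_in[of "ratio ` S"] S by fastforce
  define k where "k = ratio X"
  have XB: "X \<subseteq> B" "X \<noteq> {}" and fX: "finite X" using X B finite_subset by (auto simp: S_def)
  have k0: "k \<ge> 0" by (simp add: k_def ratio_def)
  have minimal: "k * real (card Z) \<le> real (card (Z + C))" if "Z \<subseteq> X" for Z
  proof (cases "Z = {}")
    case False
    then have "Z \<in> S" using that XB by (auto simp: S_def)
    then have "k \<le> ratio Z" unfolding k_def X(2) using S by auto
    moreover have "card Z > 0" using False that fX finite_subset by (auto simp: card_gt_0_iff)
    ultimately show ?thesis by (simp add: ratio_def field_simps)
  qed simp
  have eq: "real (card (X + C)) \<le> k * real (card X)"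
    using XB fX by (simp add: k_def ratio_def)
  have "k \<le> ratio B" unfolding k_def X(2) using S by auto
  also have "\<dots> \<le> K" using small B by (simp add: ratio_def field_simps card_gt_0_iff)
  finally have kK: "k \<le> K" .
  have "real (card (X + iterated_sumset n C)) \<le> k ^ n * real (card X)" for n
  proof (induction n)
    case (Suc n)
    have "real (card (X + iterated_sumset (Suc n) C)) = real (card (X + C + iterated_sumset n C))"
      by (simp add: iterated_sumset_Suc add.assoc)
    also have "\<dots> \<le> k * real (card (X + iterated_sumset n C))"
      by (rule petridis[OF fX C finite_iterated_sumset[OF C] k0 eq minimal])
    also have "\<dots> \<le> k * (k ^ n * real (card X))"
      using Suc k0 by (intro mult_left_mono)
    finally show ?case by (simp add: mult.assoc)
  qed simp
  moreover have "k ^ n * real (card X) \<le> K ^ n * real (card X)" for n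
    using k0 kK by (intro mult_right_mono power_mono) auto
  ultimately show thesis
    using that XB by (meson order_trans)
qed

text \<open>
Fix for every difference \<open>d\<close> a representation \<open>d = u - v\<close>; then \<open>(x, d)\<close> can be recovered from
\<open>(x + u, x + v)\<close>.
\<close>
lemma ruzsa_triangle:
  fixes X U V :: "'a::ab_group_add set"
  assumes "finite X" "finite U" "finite V"
  shows "card X * card (U + uminus ` V) \<le> card (X + U) * card (X + V)"
proof -
  have "\<forall>d\<in>U + uminus ` V. \<exists>p. fst p \<in> U \<and> snd p \<in> V \<and> d = fst p - snd p"
    by (auto elim!: set_plus_elim)
  then obtain p where p: "\<And>d. d \<in> U + uminus ` V \<Longrightarrow> fst (p d) \<in> U \<and> snd (p d) \<in> V \<and> d = fst (p d) - snd (p d)"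
    by metis
  let ?h = "\<lambda>(x, d). (x + fst (p d), x + snd (p d))"
  have "inj_on ?h (X \<times> (U + uminus ` V))"
  proof (rule inj_onI, clarsimp)
    fix x d y e assume d: "d \<in> U + uminus ` V" and e: "e \<in> U + uminus ` V"
      and eq: "x + fst (p d) = y + fst (p e)" "x + snd (p d) = y + snd (p e)"
    have "d = e"
      using p[OF d] p[OF e] eq by (metis add_diff_cancel_left)
    then show "x = y \<and> d = e" using eq by simp
  qed
  moreover have "?h ` (X \<times> (U + uminus ` V)) \<subseteq> (X + U) \<times> (X + V)"
    using p by auto
  ultimately have "card (X \<times> (U + uminus ` V)) \<le> card ((X + U) \<times> (X + V))"
    using assms by (intro card_inj_on_le[where f = ?h]) (auto intro: finite_set_plus)
  then show ?thesis by (simp add: card_cartesian_product)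
qed

lemma uminus_iterated_sumset:
  fixes B :: "'a::ab_group_add set"
  shows "uminus ` iterated_sumset n B = iterated_sumset n (uminus ` B)"
proof (induction n)
  case (Suc n)
  have "uminus ` (B + iterated_sumset n B) = uminus ` B + uminus ` iterated_sumset n B"
    unfolding set_plus_image image_image by (force simp: image_iff)
  then show ?case using Suc by (simp add: iterated_sumset_Suc)
qed simp

text \<open>
Taking \<open>C = - B\<close> in \<open>plunnecke_petridis\<close> bounds \<open>X - n B\<close>; the triangle inequality with pivot \<open>X\<close> turns this into a
bound for \<open>n B - n B\<close>.
\<close>
lemma card_iterated_difference_set_le:
  fixes B :: "'a::ab_group_add set" and K :: real
  assumes B: "finite B" "B \<noteq> {}"
    and small: "real (card (B + uminus ` B)) \<le> K * real (card B)"
  shows "real (card (iterated_sumset n B + iterated_sumset n (uminus ` B))) \<le> K ^ (2 * n) * real (card B)"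
proof -
  obtain X where X: "X \<subseteq> B" "X \<noteq> {}"
      and Xn: "\<And>n. real (card (X + iterated_sumset n (uminus ` B))) \<le> K ^ n * real (card X)"
    using plunnecke_petridis[OF B _ small] B by auto
  have fX: "finite X" and cX: "card X > 0" using X B finite_subset by (auto simp: card_gt_0_iff)
  let ?U = "iterated_sumset n (uminus ` B)"
  have "real (card X) * real (card (?U + uminus ` ?U)) \<le> real (card (X + ?U)) * real (card (X + ?U))"
    using ruzsa_triangle[OF fX, of ?U ?U] B
    by (simp add: finite_iterated_sumset flip: of_nat_mult)
  also have "\<dots> \<le> (K ^ n * real (card X)) * (K ^ n * real (card X))"
    by (intro mult_mono Xn) (use Xn[of n] in \<open>auto intro: order_trans[rotated]\<close>)
  finally have "real (card (?U + uminus ` ?U)) \<le> K ^ n * K ^ n * real (card X)"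
    using cX by (simp add: mult_ac)
  also have "\<dots> \<le> K ^ n * K ^ n * real (card B)"
    using card_mono[OF B(1) X(1)] by (intro mult_left_mono) auto
  finally show ?thesis
    by (simp add: uminus_iterated_sumset image_image add.commute power_add mult_2)
qed

section \<open>From energy to small doubling\<close>

lemma card_Collect_eq_sum_of_bool:
  "finite S \<Longrightarrow> real (card {x \<in> S. P x}) = (\<Sum>x\<in>S. of_bool (P x))"
  by (simp add: of_bool_def sum.If_cases Int_def)

text \<open>
Join two elements of \<open>B\<close> by an edge when their difference has many representations.  Large energy
makes this graph dense, so the neighbourhood \<open>N v\<close> of a suitable vertex is large and contains few
pairs with few common neighbours: a pair with few common neighbours lies in few neighbourhoods.  Removing
from \<open>N v\<close> the vertices that lie in many bad pairs leaves \<open>B'\<close>.  Any two elements of \<open>B'\<close> are then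
joined by very many paths of length four, so that every element of \<open>B' - B'\<close> is in very many ways a sum of four
popular differences.  As there are only \<open>O(card B)\<close> popular differences, \<open>B' - B'\<close> is small.
\<close>
theorem balog_szemeredi_gowers:
  fixes B :: "'a::ab_group_add set" and \<delta> :: real
  assumes B: "finite B" "B \<noteq> {}" and \<delta>: "\<delta> > 0"
    and energy: "\<delta> * real (card B) ^ 3 \<le> real (additive_energy B)"
  obtains B' where "B' \<subseteq> B" "B' \<noteq> {}" "\<delta> / 8 * real (card B) \<le> real (card B')"
    "real (card (B' + uminus ` B')) \<le> 4096 / (\<delta> / 2) ^ 10 * real (card B')"
proof -
  define M where "M = real (card B)"
  have M: "M > 0" using B by (simp add: M_def card_gt_0_iff)
  define \<gamma> where "\<gamma> = \<delta> / 2"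
  have \<gamma>: "\<gamma> > 0" using \<delta> by (simp add: \<gamma>_def)
  define r where "r x = card {p \<in> B \<times> B. fst p - snd p = x}" for x
  define Pop where "Pop = {x. \<gamma> * M \<le> real (r x)}"
  have r_pos: "x \<in> (\<lambda>p. fst p - snd p) ` (B \<times> B)" if "x \<in> Pop" for x
  proof -
    have "0 < \<gamma> * M" using \<gamma> M by simp
    then have "r x \<noteq> 0" using that by (auto simp: Pop_def)
    then have "{p \<in> B \<times> B. fst p - snd p = x} \<noteq> {}" unfolding r_def by (metis card.empty)
    then show ?thesis by (auto simp: image_iff)
  qed
  then have finPop: "finite Pop" using B by (meson finite_SigmaI finite_imageI finite_subset subsetI)
  have r_le: "real (r x) \<le> M" for x
  proof -
    have "card {p \<in> B \<times> B. fst p - snd p = x} \<le> card B"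
      using B by (intro card_inj_on_le[of fst]) (auto intro!: inj_onI)
    then show ?thesis by (simp add: r_def M_def)
  qed
  have r_uminus: "r (- x) = r x" for x
  proof -
    have "a - b = - x \<longleftrightarrow> b - a = x" for a b :: 'a
      by (metis minus_diff_eq minus_minus)
    then show ?thesis
      unfolding r_def by (intro bij_betw_same_card[of prod.swap] bij_betwI[of _ _ _ prod.swap]) auto
  qed
  have Pop_sym: "a - b \<in> Pop \<longleftrightarrow> b - a \<in> Pop" for a b
    using r_uminus[of "a - b"] by (simp add: Pop_def)

  \<comment> \<open>the representations of distinct differences are disjoint subsets of \<open>B \<times> B\<close>\<close>
  have cardPop: "real (card Pop) * \<gamma> \<le> M"
  proof -
    have "real (card Pop) * (\<gamma> * M) = (\<Sum>x\<in>Pop. \<gamma> * M)" by simp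
    also have "\<dots> \<le> (\<Sum>x\<in>Pop. real (r x))"
      by (intro sum_mono) (auto simp: Pop_def)
    also have "\<dots> = real (card (\<Union>x\<in>Pop. {p \<in> B \<times> B. fst p - snd p = x}))"
      using B finPop by (subst card_UN_disjoint) (auto simp: r_def)
    also have "\<dots> \<le> real (card (B \<times> B))"
      using B by (intro of_nat_mono card_mono) auto
    also have "\<dots> = M * M" by (simp add: M_def card_cartesian_product)
    finally show ?thesis using M by (simp add: mult.assoc[symmetric])
  qed

  \<comment> \<open>unpopular differences account for at most half of the energy\<close>
  define N where "N v = {a \<in> B. a - v \<in> Pop}" for v
  have finN: "finite (N v)" for v using B by (simp add: N_def)
  have edges: "\<gamma> * M\<^sup>2 \<le> (\<Sum>v\<in>B. real (card (N v)))"
  proof -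
    have "{(a, b, c, d). a \<in> B \<and> b \<in> B \<and> c \<in> B \<and> d \<in> B \<and> a - b = c - d}
        = (\<lambda>((a, b), (c, d)). (a, b, c, d)) ` (SIGMA p:B \<times> B. {q \<in> B \<times> B. fst q - snd q = fst p - snd p})"
      by (auto simp: image_iff)
    then have "additive_energy B = card (SIGMA p:B \<times> B. {q \<in> B \<times> B. fst q - snd q = fst p - snd p})"
      unfolding additive_energy_def by (simp add: card_image inj_on_def split_beta prod_eq_iff)
    also have "\<dots> = (\<Sum>p\<in>B \<times> B. r (fst p - snd p))"
      using B by (subst card_SigmaI) (auto simp: r_def)
    finally have "real (additive_energy B) = (\<Sum>p\<in>B \<times> B. real (r (fst p - snd p)))"
      by simp
    also have "\<dots> \<le> (\<Sum>p\<in>B \<times> B. M * of_bool (fst p - snd p \<in> Pop) + \<gamma> * M)"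
      using r_le \<gamma> M by (intro sum_mono) (auto simp: Pop_def of_bool_def intro: order_trans[OF r_le])
    also have "\<dots> = M * (\<Sum>p\<in>B \<times> B. of_bool (fst p - snd p \<in> Pop)) + \<gamma> * M * M\<^sup>2"
      by (simp add: sum.distrib sum_distrib_left card_cartesian_product M_def power2_eq_square)
    also have "(\<Sum>p\<in>B \<times> B. of_bool (fst p - snd p \<in> Pop)) = (\<Sum>v\<in>B. real (card (N v)))"
      unfolding N_def card_Collect_eq_sum_of_bool[OF B(1)]
      by (subst sum.swap) (simp add: sum.cartesian_product case_prod_beta)
    finally have "2 * \<gamma> * M ^ 3 \<le> M * (\<Sum>v\<in>B. real (card (N v))) + \<gamma> * M * M\<^sup>2"
      using energy by (simp add: \<gamma>_def M_def)
    then have "M * (\<gamma> * M\<^sup>2) \<le> M * (\<Sum>v\<in>B. real (card (N v)))"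
      by (simp add: power2_eq_square power3_eq_cube algebra_simps)
    then show ?thesis using M by simp
  qed

  \<comment> \<open>with this \<open>\<epsilon>\<close>, eight times the number of bad pairs is on average at most half of the lower bound for \<open>(card (N v))\<^sup>2\<close>\<close>
  define \<epsilon> where "\<epsilon> = \<gamma>\<^sup>2 / 16"
  define bad where "bad a b \<longleftrightarrow> real (card {v \<in> B. a - v \<in> Pop \<and> b - v \<in> Pop}) < \<epsilon> * M" for a b
  have bad_sym: "bad a b \<longleftrightarrow> bad b a" for a b
    by (simp add: bad_def conj_commute)
  define badN where "badN v = {p \<in> N v \<times> N v. bad (fst p) (snd p)}" for v
  have sum_squares: "\<gamma>\<^sup>2 * M ^ 3 \<le> (\<Sum>v\<in>B. (real (card (N v)))\<^sup>2)"
  proof -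
    have "(\<gamma> * M\<^sup>2)\<^sup>2 \<le> (\<Sum>v\<in>B. real (card (N v)))\<^sup>2"
      using edges \<gamma> by (intro power_mono) auto
    also have "\<dots> \<le> (\<Sum>v\<in>B. (real (card (N v)))\<^sup>2) * real (card B)"
      by (rule sum_squared_le_sum_of_squares)
    finally have "M * (\<gamma>\<^sup>2 * M ^ 3) \<le> M * (\<Sum>v\<in>B. (real (card (N v)))\<^sup>2)"
      by (simp add: M_def power2_eq_square power3_eq_cube mult_ac)
    then show ?thesis using M by simp
  qed
  have sum_bad: "(\<Sum>v\<in>B. real (card (badN v))) \<le> \<epsilon> * M ^ 3"
  proof -
    have "(\<Sum>v\<in>B. real (card (badN v)))
        = (\<Sum>v\<in>B. \<Sum>p\<in>B \<times> B. of_bool (bad (fst p) (snd p) \<and> fst p - v \<in> Pop \<and> snd p - v \<in> Pop))"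
    proof (intro sum.cong refl)
      fix v
      have "badN v = {p \<in> B \<times> B. bad (fst p) (snd p) \<and> fst p - v \<in> Pop \<and> snd p - v \<in> Pop}"
        by (auto simp: badN_def N_def)
      then show "real (card (badN v)) = (\<Sum>p\<in>B \<times> B. of_bool (bad (fst p) (snd p) \<and> fst p - v \<in> Pop \<and> snd p - v \<in> Pop))"
        using B by (simp only: card_Collect_eq_sum_of_bool finite_SigmaI)
    qed
    also have "\<dots> = (\<Sum>p\<in>B \<times> B. of_bool (bad (fst p) (snd p)) * real (card {v \<in> B. fst p - v \<in> Pop \<and> snd p - v \<in> Pop}))"
      unfolding card_Collect_eq_sum_of_bool[OF B(1)] sum_distrib_left
      by (subst sum.swap) (auto intro!: sum.cong)
    also have "\<dots> \<le> (\<Sum>p\<in>B \<times> B. \<epsilon> * M)"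
      using M by (intro sum_mono) (auto simp: bad_def \<epsilon>_def)
    also have "\<dots> = \<epsilon> * M ^ 3"
      by (simp add: card_cartesian_product M_def power3_eq_cube)
    finally show ?thesis .
  qed
  have "\<exists>v\<in>B. \<gamma>\<^sup>2 * M\<^sup>2 / 2 \<le> (real (card (N v)))\<^sup>2 - 8 * real (card (badN v))"
  proof (rule ccontr)
    assume "\<not> ?thesis"
    then have "(\<Sum>v\<in>B. (real (card (N v)))\<^sup>2 - 8 * real (card (badN v))) < (\<Sum>v\<in>B. \<gamma>\<^sup>2 * M\<^sup>2 / 2)"
      using B by (intro sum_strict_mono) (auto simp: not_le)
    also have "\<dots> = \<gamma>\<^sup>2 * M ^ 3 / 2"
      by (simp add: M_def power2_eq_square power3_eq_cube)
    finally have "(\<Sum>v\<in>B. (real (card (N v)))\<^sup>2) - 8 * (\<Sum>v\<in>B. real (card (badN v))) < \<gamma>\<^sup>2 * M ^ 3 / 2"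
      by (simp add: sum_subtractf sum_distrib_left)
    moreover have "8 * (\<epsilon> * M ^ 3) = \<gamma>\<^sup>2 * M ^ 3 / 2" by (simp add: \<epsilon>_def)
    ultimately show False using sum_squares sum_bad by linarith
  qed
  then obtain v where v: "v \<in> B" "\<gamma>\<^sup>2 * M\<^sup>2 / 2 \<le> (real (card (N v)))\<^sup>2 - 8 * real (card (badN v))"
    by blast
  define n where "n = real (card (N v))"
  have "(\<gamma> * M / 2)\<^sup>2 \<le> n\<^sup>2"
  proof -
    have "(\<gamma> * M / 2)\<^sup>2 \<le> \<gamma>\<^sup>2 * M\<^sup>2 / 2" by (simp add: power_mult_distrib power_divide)
    then show ?thesis using v by (simp add: n_def)
  qed
  then have n_lower: "\<gamma> * M / 2 \<le> n"
    by (rule power2_le_imp_le) (simp add: n_def)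
  then have n_pos: "n > 0" using \<gamma> M by (smt (verit) mult_pos_pos half_gt_zero)
  have bad_upper: "8 * real (card (badN v)) \<le> n\<^sup>2"
    using v by (simp add: n_def) (smt (verit) zero_le_power2 mult_nonneg_nonneg)

  define B' where "B' = {a \<in> N v. real (card {b \<in> N v. bad a b}) \<le> n / 4}"
  have B'N: "B' \<subseteq> N v" by (auto simp: B'_def)
  have B'B: "B' \<subseteq> B" by (auto simp: B'_def N_def)
  have B'_large: "n / 2 \<le> real (card B')"
  proof -
    have "real (card (N v - B')) * (n / 4) = (\<Sum>a\<in>N v - B'. n / 4)" by simp
    also have "\<dots> \<le> (\<Sum>a\<in>N v - B'. real (card {b \<in> N v. bad a b}))"
      by (intro sum_mono) (auto simp: B'_def)
    also have "\<dots> \<le> (\<Sum>a\<in>N v. real (card {b \<in> N v. bad a b}))"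
      using finN by (intro sum_mono2) auto
    also have "\<dots> = real (card (SIGMA a:N v. {b \<in> N v. bad a b}))"
      using finN by (subst card_SigmaI) auto
    also have "(SIGMA a:N v. {b \<in> N v. bad a b}) = badN v"
      by (auto simp: badN_def)
    also have "real (card (badN v)) \<le> n * (n / 8)"
      using bad_upper by (simp add: power2_eq_square)
    finally have "n * real (card (N v - B')) \<le> n * (n / 2)" by (simp add: mult_ac)
    then have "real (card (N v - B')) \<le> n / 2" using n_pos by simp
    moreover have "card (N v - B') = card (N v) - card B'" "card B' \<le> card (N v)"
      using B'N finN finite_subset by (auto intro!: card_Diff_subset card_mono)
    ultimately show ?thesis by (simp add: n_def of_nat_diff)
  qed

  \<comment> \<open>a path \<open>a, u, c, w, b\<close> is encoded by its four consecutive differences\<close>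
  define Q where "Q x = {(d1, d2, d3, d4). d1 \<in> Pop \<and> d2 \<in> Pop \<and> d3 \<in> Pop \<and> d4 \<in> Pop \<and> d1 + d2 + d3 + d4 = x}" for x
  define \<kappa> where "\<kappa> = \<gamma> / 4 * \<epsilon>\<^sup>2"
  have Q_large: "\<kappa> * M ^ 3 \<le> real (card (Q (a - b)))" if ab: "a \<in> B'" "b \<in> B'" for a b
  proof -
    define Mid where "Mid = N v - {c \<in> N v. bad a c} - {c \<in> N v. bad b c}"
    have "card (N v) \<le> card (Mid \<union> {c \<in> N v. bad a c} \<union> {c \<in> N v. bad b c})"
      using finN by (intro card_mono) (auto simp: Mid_def)
    also have "\<dots> \<le> card Mid + card {c \<in> N v. bad a c} + card {c \<in> N v. bad b c}"
      by (meson add_le_mono1 card_Un_le order_trans)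
    finally have "n \<le> real (card Mid) + real (card {c \<in> N v. bad a c}) + real (card {c \<in> N v. bad b c})"
      by (simp add: n_def flip: of_nat_add)
    then have Mid: "n / 2 \<le> real (card Mid)" using ab by (simp add: B'_def)
    have finMid: "finite Mid" using finN by (simp add: Mid_def)
    define nb where "nb a c = {u \<in> B. a - u \<in> Pop \<and> c - u \<in> Pop}" for a c
    have finnb: "finite (nb a c)" for a c using B by (simp add: nb_def)
    define paths where "paths = (SIGMA c:Mid. nb a c \<times> nb b c)"
    have "\<kappa> * M ^ 3 = (\<gamma> * M / 2) / 2 * (\<epsilon> * M * (\<epsilon> * M))"
      by (simp add: \<kappa>_def power2_eq_square power3_eq_cube)
    also have "\<dots> \<le> n / 2 * (\<epsilon> * M * (\<epsilon> * M))"
      by (rule mult_right_mono) (use n_lower M in \<open>linarith, simp add: \<epsilon>_def\<close>)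
    also have "\<dots> \<le> real (card Mid) * (\<epsilon> * M * (\<epsilon> * M))"
      using Mid M by (intro mult_right_mono) (auto simp: \<epsilon>_def)
    also have "\<dots> = (\<Sum>c\<in>Mid. \<epsilon> * M * (\<epsilon> * M))" by simp
    also have "\<dots> \<le> (\<Sum>c\<in>Mid. real (card (nb a c)) * real (card (nb b c)))"
      using M by (intro sum_mono mult_mono) (auto simp: Mid_def bad_def nb_def \<epsilon>_def)
    also have "\<dots> = real (card paths)"
      unfolding paths_def using finMid finnb by (subst card_SigmaI) (auto simp: card_cartesian_product)
    finally have paths: "\<kappa> * M ^ 3 \<le> real (card paths)" .
    have "card paths \<le> card (Q (a - b))"
    proof (rule card_inj_on_le[of "\<lambda>(c, u, w). (a - u, u - c, c - w, w - b)"])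
      show "inj_on (\<lambda>(c, u, w). (a - u, u - c, c - w, w - b)) paths"
        by (auto intro!: inj_onI)
      show "(\<lambda>(c, u, w). (a - u, u - c, c - w, w - b)) ` paths \<subseteq> Q (a - b)"
        using Pop_sym by (auto simp: paths_def nb_def Q_def)
      have "Q (a - b) \<subseteq> Pop \<times> Pop \<times> Pop \<times> Pop" by (auto simp: Q_def)
      then show "finite (Q (a - b))" using finPop finite_subset by blast
    qed
    then show ?thesis using paths by simp
  qed

  define D where "D = B' + uminus ` B'"
  have finD: "finite D" using B'B B finite_subset unfolding D_def by (blast intro: finite_set_plus)
  have "real (card D) * (\<kappa> * M ^ 3) = (\<Sum>x\<in>D. \<kappa> * M ^ 3)" by simp
  also have "\<dots> \<le> (\<Sum>x\<in>D. real (card (Q x)))"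
  proof (intro sum_mono)
    fix x assume "x \<in> D"
    then obtain a b where "a \<in> B'" "b \<in> B'" "x = a - b" by (auto simp: D_def elim!: set_plus_elim)
    then show "\<kappa> * M ^ 3 \<le> real (card (Q x))" using Q_large by simp
  qed
  also have "\<dots> = real (card (\<Union>x\<in>D. Q x))"
  proof -
    have "Q x \<subseteq> Pop \<times> Pop \<times> Pop \<times> Pop" for x by (auto simp: Q_def)
    then have "finite (Q x)" for x using finPop by (meson finite_SigmaI finite_subset)
    then show ?thesis using finD by (subst card_UN_disjoint) (auto simp: Q_def)
  qed
  also have "\<dots> \<le> real (card (Pop \<times> Pop \<times> Pop \<times> Pop))"
    using finPop by (intro of_nat_mono card_mono) (auto simp: Q_def)
  also have "\<dots> = real (card Pop) ^ 4"
    by (simp add: card_cartesian_product power4_eq_xxxx mult_ac)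
  also have "\<dots> \<le> (M / \<gamma>) ^ 4"
    using cardPop \<gamma> by (intro power_mono) (auto simp: field_simps)
  finally have "real (card D) * (\<kappa> * M ^ 3) \<le> M / \<gamma> ^ 4 * M ^ 3"
    by (simp add: power_divide power4_eq_xxxx power3_eq_cube mult_ac)
  then have "real (card D) * \<kappa> \<le> M / \<gamma> ^ 4"
    using M by (simp add: mult.assoc[symmetric] del: times_divide_eq_left)
  also have "M / \<gamma> ^ 4 \<le> 4 / \<gamma> ^ 5 * real (card B')"
  proof -
    have "\<gamma> * M / 4 \<le> real (card B')" using B'_large n_lower by simp
    then have "4 / \<gamma> ^ 5 * (\<gamma> * M / 4) \<le> 4 / \<gamma> ^ 5 * real (card B')"
      using \<gamma> by (intro mult_left_mono) auto
    also have "4 / \<gamma> ^ 5 * (\<gamma> * M / 4) = M / \<gamma> ^ 4"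
      using \<gamma> by (simp add: eval_nat_numeral)
    finally show ?thesis by simp
  qed
  finally have D_le: "real (card D) * \<kappa> \<le> 4 / \<gamma> ^ 5 * real (card B')" .
  have "\<kappa> = \<gamma> ^ 5 / 1024"
    by (simp add: \<kappa>_def \<epsilon>_def eval_nat_numeral)
  then have "\<kappa> * (1024 / \<gamma> ^ 5) = 1"
    using \<gamma> by simp
  then have "real (card D) = real (card D) * \<kappa> * (1024 / \<gamma> ^ 5)"
    by (simp only: mult.assoc)
  also have "\<dots> \<le> 4 / \<gamma> ^ 5 * real (card B') * (1024 / \<gamma> ^ 5)"
    using D_le \<gamma> by (intro mult_right_mono) auto
  also have "\<dots> = 4096 / \<gamma> ^ 10 * real (card B')"
    by (simp flip: power_add)
  finally have D_final: "real (card D) \<le> 4096 / \<gamma> ^ 10 * real (card B')" .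

  show thesis
  proof (rule that[OF B'B])
    show "B' \<noteq> {}" using B'_large n_pos by auto
    show "\<delta> / 8 * real (card B) \<le> real (card B')"
      using B'_large n_lower by (simp add: \<gamma>_def M_def)
    show "real (card (B' + uminus ` B')) \<le> 4096 / (\<delta> / 2) ^ 10 * real (card B')"
      using D_final by (simp add: D_def \<gamma>_def)
  qed
qed

section \<open>Bogolyubov's lemma\<close>

lemma sum_cis_residues:
  fixes n x :: int
  assumes n: "n > 0"
  shows "(\<Sum>k\<in>{0..<n}. cis (2 * pi * (of_int (k * x) / of_int n))) = (if n dvd x then of_int n else 0)"
proof -
  define \<omega> where "\<omega> = cis (2 * pi * (of_int x / of_int n))"
  define N where "N = nat n"
  have N: "n = int N" "N > 0" using n by (auto simp: N_def)
  have "(\<Sum>k\<in>{0..<n}. cis (2 * pi * (of_int (k * x) / of_int n))) = (\<Sum>k<N. \<omega> ^ k)"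
    by (rule sum.reindex_bij_witness[of _ int nat]) (auto simp: N \<omega>_def Complex.DeMoivre field_simps)
  also have "\<dots> = (if n dvd x then of_int n else 0)"
  proof (cases "n dvd x")
    case True
    then obtain y where "x = n * y" by blast
    then have "\<omega> = 1" using n by (simp add: \<omega>_def)
    then show ?thesis using True by (simp add: N)
  next
    case False
    have "\<omega> \<noteq> 1"
    proof
      assume "\<omega> = 1"
      then have "cos (2 * pi * (of_int x / of_int n)) = 1" by (simp add: \<omega>_def complex_eq_iff)
      then obtain j :: int where "2 * pi * (of_int x / of_int n) = of_int j * 2 * pi"
        by (auto simp: cos_one_2pi_int)
      then have "(of_int x / of_int n - of_int j) * (2 * pi) = 0" by (simp add: algebra_simps)
      then have "of_int x / of_int n = (of_int j :: real)" by simp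
      then have "real_of_int x = of_int (j * n)" using n by (simp add: field_simps)
      then have "x = j * n" by (simp only: of_int_eq_iff)
      then show False using False by simp
    qed
    moreover have "\<omega> ^ N = 1"
      using n by (simp add: \<omega>_def Complex.DeMoivre N)
    ultimately show ?thesis using False by (simp add: sum_gp_strict)
  qed
  finally show ?thesis .
qed

text \<open>
With \<open>f\<close> the discrete Fourier transform of \<open>X\<close> modulo \<open>n\<close>, the number of representations of \<open>s\<close>, times \<open>n\<close>, is the
sum over \<open>k\<close> of \<open>\<bar>f k\<bar> ^ 4 * cos (2 * pi * k * s / n)\<close>.  The term \<open>k = 0\<close> contributes \<open>card X ^ 4\<close>.  Let \<open>S\<close> be the
set of frequencies with large \<open>\<bar>f k\<bar>\<close>: outside \<open>S\<close> the terms sum to at most half of the main term by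
Parseval, and on \<open>S\<close> they are nonnegative by the hypothesis on \<open>s\<close>.  Parseval also bounds \<open>S\<close>.
\<close>
lemma bogolyubov:
  fixes X :: "int set" and n :: int
  assumes n: "n > 0" and X: "finite X" "X \<noteq> {}" and inj: "inj_on (\<lambda>x. x mod n) X"
  defines "\<alpha> \<equiv> real (card X) / of_int n"
  obtains S where "S \<subseteq> {0..<n}" "real (card S) * \<alpha>\<^sup>2 \<le> 2"
    "\<And>s. (\<And>k. k \<in> S \<Longrightarrow> cos (2 * pi * (of_int (k * s) / of_int n)) \<ge> 0) \<Longrightarrow>
      \<exists>x1\<in>X. \<exists>x2\<in>X. \<exists>x3\<in>X. \<exists>x4\<in>X. n dvd x1 + x2 - x3 - x4 - s"
proof -
  define e where "e k x = cis (2 * pi * (of_int (k * x) / of_int n))" for k x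
  have e_mult: "e k x * e k y = e k (x + y)" for k x y
    by (simp add: e_def cis_mult distrib_left add_divide_distrib)
  have e_cnj: "cnj (e k x) = e k (- x)" for k x
    by (simp add: e_def cis_cnj)
  define f where "f k = (\<Sum>x\<in>X. e k x)" for k
  define M where "M = real (card X)"
  have M: "M > 0" using X by (simp add: M_def card_gt_0_iff)
  have \<alpha>: "\<alpha> > 0" "\<alpha> * of_int n = M" using M n by (auto simp: \<alpha>_def M_def)
  have f2: "complex_of_real ((norm (f k))\<^sup>2) = (\<Sum>x\<in>X. \<Sum>y\<in>X. e k (x - y))" for k
    unfolding complex_norm_square f_def cnj_sum sum_product e_cnj by (simp add: e_mult)
  have parseval: "(\<Sum>k\<in>{0..<n}. (norm (f k))\<^sup>2) = of_int n * M"
  proof -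
    have "complex_of_real (\<Sum>k\<in>{0..<n}. (norm (f k))\<^sup>2) = (\<Sum>k\<in>{0..<n}. \<Sum>x\<in>X. \<Sum>y\<in>X. e k (x - y))"
      by (simp only: of_real_sum f2)
    also have "\<dots> = (\<Sum>x\<in>X. \<Sum>k\<in>{0..<n}. \<Sum>y\<in>X. e k (x - y))"
      by (rule sum.swap)
    also have "\<dots> = (\<Sum>x\<in>X. \<Sum>y\<in>X. \<Sum>k\<in>{0..<n}. e k (x - y))"
      by (intro sum.cong refl sum.swap)
    also have "\<dots> = (\<Sum>x\<in>X. \<Sum>y\<in>X. if x = y then of_int n else 0)"
    proof (intro sum.cong refl)
      fix x y assume "x \<in> X" "y \<in> X"
      then have "n dvd x - y \<longleftrightarrow> x = y"
        using inj by (auto simp: inj_on_def mod_eq_dvd_iff)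
      then show "(\<Sum>k\<in>{0..<n}. e k (x - y)) = (if x = y then of_int n else 0)"
        unfolding e_def sum_cis_residues[OF n] by simp
    qed
    also have "\<dots> = complex_of_real (of_int n * M)"
      using X by (simp add: M_def)
    finally show ?thesis by (simp only: of_real_eq_iff)
  qed
  define S where "S = {k \<in> {0..<n}. \<alpha> / 2 * M\<^sup>2 \<le> (norm (f k))\<^sup>2}"
  have "real (card S) * (\<alpha> / 2 * M\<^sup>2) \<le> of_int n * M"
  proof -
    have "real (card S) * (\<alpha> / 2 * M\<^sup>2) = (\<Sum>k\<in>S. \<alpha> / 2 * M\<^sup>2)" by simp
    also have "\<dots> \<le> (\<Sum>k\<in>S. (norm (f k))\<^sup>2)"
      by (intro sum_mono) (auto simp: S_def)
    also have "\<dots> \<le> (\<Sum>k\<in>{0..<n}. (norm (f k))\<^sup>2)"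
      by (intro sum_mono2) (auto simp: S_def)
    finally show ?thesis by (simp add: parseval)
  qed
  then have "real (card S) * (\<alpha> / 2 * M\<^sup>2) * \<alpha> \<le> of_int n * M * \<alpha>"
    using \<alpha> by (intro mult_right_mono) auto
  also have "of_int n * M * \<alpha> = 1 * M\<^sup>2" using \<alpha>(2) by (simp add: power2_eq_square mult_ac)
  finally have "(real (card S) * \<alpha>\<^sup>2 / 2) * M\<^sup>2 \<le> 1 * M\<^sup>2"
    by (simp add: power2_eq_square mult_ac)
  then have cardS: "real (card S) * \<alpha>\<^sup>2 \<le> 2"
    using M by (simp only: mult_le_cancel_right) (auto simp: not_less power2_eq_square)

  have main: "\<exists>x1\<in>X. \<exists>x2\<in>X. \<exists>x3\<in>X. \<exists>x4\<in>X. n dvd x1 + x2 - x3 - x4 - s"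
    if s: "\<And>k. k \<in> S \<Longrightarrow> cos (2 * pi * (of_int (k * s) / of_int n)) \<ge> 0" for s
  proof (rule ccontr)
    assume none: "\<not> ?thesis"
    have "complex_of_real ((norm (f k)) ^ 4) * e k (- s)
        = (\<Sum>x1\<in>X. \<Sum>x3\<in>X. \<Sum>x2\<in>X. \<Sum>x4\<in>X. e k (x1 + x2 - x3 - x4 - s))" for k
    proof -
      have "complex_of_real ((norm (f k)) ^ 4) * e k (- s)
          = complex_of_real ((norm (f k))\<^sup>2) * complex_of_real ((norm (f k))\<^sup>2) * e k (- s)"
        by (simp add: power_numeral_reduce)
      also have "\<dots> = (\<Sum>x1\<in>X. \<Sum>x3\<in>X. \<Sum>x2\<in>X. \<Sum>x4\<in>X. e k (x1 + x2 - x3 - x4 - s))"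
        unfolding f2 sum_distrib_left sum_distrib_right
        by (simp only: e_mult) (simp add: algebra_simps)
      finally show ?thesis .
    qed
    then have "(\<Sum>k\<in>{0..<n}. complex_of_real ((norm (f k)) ^ 4) * e k (- s))
        = (\<Sum>k\<in>{0..<n}. \<Sum>q\<in>X \<times> X \<times> X \<times> X. case q of (x1, x3, x2, x4) \<Rightarrow> e k (x1 + x2 - x3 - x4 - s))"
      by (simp add: sum.cartesian_product)
    also have "\<dots> = (\<Sum>q\<in>X \<times> X \<times> X \<times> X. \<Sum>k\<in>{0..<n}. case q of (x1, x3, x2, x4) \<Rightarrow> e k (x1 + x2 - x3 - x4 - s))"
      by (rule sum.swap)
    also have "\<dots> = 0"
    proof (rule sum.neutral, rule ballI)
      fix q assume "q \<in> X \<times> X \<times> X \<times> X"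
      then obtain x1 x3 x2 x4 where q: "q = (x1, x3, x2, x4)" "x1 \<in> X" "x2 \<in> X" "x3 \<in> X" "x4 \<in> X"
        by auto
      have "(\<Sum>k\<in>{0..<n}. e k (x1 + x2 - x3 - x4 - s)) = 0"
        unfolding e_def sum_cis_residues[OF n] using none q by auto
      then show "(\<Sum>k\<in>{0..<n}. case q of (x1, x3, x2, x4) \<Rightarrow> e k (x1 + x2 - x3 - x4 - s)) = 0"
        by (simp add: q)
    qed
    finally have "Re (\<Sum>k\<in>{0..<n}. complex_of_real ((norm (f k)) ^ 4) * e k (- s)) = 0" by simp
    then have zero: "(\<Sum>k\<in>{0..<n}. (norm (f k)) ^ 4 * cos (2 * pi * (of_int (k * s) / of_int n))) = 0"
      by (simp add: e_def)
    define b where "b k = (if k = 0 then M ^ 4 else 0) - \<alpha> / 2 * M\<^sup>2 * (norm (f k))\<^sup>2" for k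
    have "(\<Sum>k\<in>{0..<n}. b k) = (\<Sum>k\<in>{0..<n}. if k = 0 then M ^ 4 else 0)
        - \<alpha> / 2 * M\<^sup>2 * (\<Sum>k\<in>{0..<n}. (norm (f k))\<^sup>2)"
      by (simp only: b_def sum_subtractf sum_distrib_left)
    also have "\<dots> = M ^ 4 - \<alpha> / 2 * M\<^sup>2 * (of_int n * M)"
      using n by (simp add: parseval)
    also have "\<dots> = M ^ 4 / 2"
      using \<alpha>(2) by (simp add: power2_eq_square power4_eq_xxxx mult_ac)
    finally have "M ^ 4 / 2 = (\<Sum>k\<in>{0..<n}. b k)" by simp
    also have "\<dots> \<le> (\<Sum>k\<in>{0..<n}. (norm (f k)) ^ 4 * cos (2 * pi * (of_int (k * s) / of_int n)))"
    proof (intro sum_mono)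
      fix k assume k: "k \<in> {0..<n}"
      have nonneg: "0 \<le> \<alpha> / 2 * M\<^sup>2 * (norm (f k))\<^sup>2" using \<alpha> by simp
      show "b k \<le> (norm (f k)) ^ 4 * cos (2 * pi * (of_int (k * s) / of_int n))"
      proof (cases "k = 0")
        case True
        then have "norm (f k) = M" by (simp add: f_def e_def M_def)
        then show ?thesis using True nonneg by (simp add: b_def)
      next
        case False
        show ?thesis
        proof (cases "k \<in> S")
          case True
          then have "0 \<le> (norm (f k)) ^ 4 * cos (2 * pi * (of_int (k * s) / of_int n))"
            using s by simp
          then show ?thesis using nonneg False by (simp add: b_def)
        next
          case notS: False
          then have "(norm (f k))\<^sup>2 * (norm (f k))\<^sup>2 \<le> \<alpha> / 2 * M\<^sup>2 * (norm (f k))\<^sup>2"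
            using k by (intro mult_right_mono) (auto simp: S_def)
          then have "(norm (f k)) ^ 4 \<le> \<alpha> / 2 * M\<^sup>2 * (norm (f k))\<^sup>2"
            by (simp add: power2_eq_square power4_eq_xxxx mult.assoc)
          moreover have "(norm (f k)) ^ 4 * (- 1) \<le> (norm (f k)) ^ 4 * cos (2 * pi * (of_int (k * s) / of_int n))"
            by (intro mult_left_mono) auto
          ultimately show ?thesis using False by (simp add: b_def)
        qed
      qed
    qed
    finally show False using zero M by simp
  qed
  show thesis
    by (rule that[of S]) (use cardS main in \<open>auto simp: S_def\<close>)
qed

section \<open>Progressions in sets of small doubling\<close>

lemma iterated_sumset_2: "iterated_sumset 2 B = B + B"
  and iterated_sumset_5: "iterated_sumset 5 B = B + (B + (B + (B + B)))"
  by (simp_all add: numeral_eq_Suc iterated_sumset_Suc flip: set_zero)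

text \<open>
A random dilation modulo a large prime spreads \<open>W\<close> out: for a fixed nonzero \<open>x\<close> the residue of \<open>q * x\<close>
is equidistributed, so it is close to \<open>0\<close> for at most \<open>8 * l\<close> values of \<open>q\<close>, and \<open>l\<close> is
chosen so that these exceptional values, over all \<open>x\<close> in \<open>W\<close>, do not exhaust the residues.
\<close>
lemma separating_dilation:
  fixes W :: "int set"
  assumes W: "finite W" "W \<noteq> {}"
  obtains n l q :: int where "n > 0" "l > 0" "l < n" "of_int n / (16 * real (card W)) \<le> of_int l"
    "\<And>x i. \<lbrakk>x \<in> W; \<bar>i\<bar> < 4 * l; n dvd q * x + i\<rbrakk> \<Longrightarrow> x = 0"
proof -
  define w where "w = int (card W)"
  have w: "w > 0" using W by (simp add: w_def card_gt_0_iff)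
  define m where "m = Max (abs ` W)"
  have m: "\<bar>x\<bar> \<le> m" if "x \<in> W" for x using that W by (simp add: m_def)
  \<comment> \<open>a prime above \<open>m\<close> makes the nonzero elements of \<open>W\<close> invertible; above \<open>16 * w\<close>, rounding in \<open>l\<close> costs a factor 2 at most\<close>
  obtain p :: nat where p: "prime p" "p > nat (m + 16 * w + 2)"
    using bigger_prime by blast
  define n where "n = int p"
  have m0: "m \<ge> 0" using m W by (metis abs_ge_zero all_not_in_conv order_trans)
  have n: "prime n" "n > m" "n \<ge> 16 * w + 2"
    using p m0 w by (auto simp: n_def)
  define l where "l = (n - 1) div (8 * w)"
  have "n - 1 = 8 * w * l + (n - 1) mod (8 * w)" by (simp add: l_def)
  moreover have "0 \<le> (n - 1) mod (8 * w)" "(n - 1) mod (8 * w) < 8 * w" using w by simp_all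
  ultimately have l_upper: "8 * w * l \<le> n - 1" and l_lower: "n - 1 < 8 * w * l + 8 * w"
    by linarith+
  have "0 < 8 * w * l" using l_lower n w by linarith
  then have l: "l > 0" using w by (simp add: zero_less_mult_iff)
  have "1 * l \<le> 8 * w * l" using w l by (intro mult_right_mono) auto
  then have ln: "l < n" using l_upper by linarith

  define bad where "bad x = {q \<in> {0..<n}. \<exists>i\<in>{-4*l<..<4*l}. n dvd q * x + i}" for x
  have card_bad: "card (bad x) \<le> nat (8 * l)" if x: "x \<in> W" "x \<noteq> 0" for x
  proof -
    have "\<not> n dvd x"
      using dvd_imp_le_int[OF x(2), of n] m[OF x(1)] n(2) by linarith
    then have cop: "n dvd z * x \<longleftrightarrow> n dvd z" for z
      using n(1) by (simp add: prime_dvd_mult_iff)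
    have "bad x \<subseteq> (\<Union>i\<in>{-4*l<..<4*l}. {q \<in> {0..<n}. n dvd q * x + i})"
      by (auto simp: bad_def)
    then have "card (bad x) \<le> card (\<Union>i\<in>{-4*l<..<4*l}. {q \<in> {0..<n}. n dvd q * x + i})"
      by (rule card_mono[rotated]) (simp del: atLeastLessThan_iff)
    also have "\<dots> \<le> (\<Sum>i\<in>{-4*l<..<4*l}. card {q \<in> {0..<n}. n dvd q * x + i})"
      by (intro card_UN_le) auto
    also have "\<dots> \<le> (\<Sum>i\<in>{-4*l<..<4*l}. 1)"
    proof (intro sum_mono)
      fix i
      have "q = q'" if q: "q \<in> {0..<n}" "q' \<in> {0..<n}" "n dvd q * x + i" "n dvd q' * x + i" for q q'
      proof -
        have "n dvd (q * x + i) - (q' * x + i)" using q by (intro dvd_diff)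
        then have "n dvd (q - q') * x" by (simp add: algebra_simps)
        then have "n dvd q - q'" using cop by blast
        then have "q mod n = q' mod n" by (simp add: mod_eq_dvd_iff)
        then show ?thesis using q by simp
      qed
      moreover have "finite {q \<in> {0..<n}. n dvd q * x + i}"
        by (simp del: atLeastLessThan_iff)
      ultimately show "card {q \<in> {0..<n}. n dvd q * x + i} \<le> 1"
        unfolding One_nat_def by (subst card_le_Suc0_iff_eq) blast+
    qed
    also have "\<dots> \<le> nat (8 * l)" by simp
    finally show ?thesis .
  qed
  have "card (\<Union>x\<in>W - {0}. bad x) \<le> (\<Sum>x\<in>W - {0}. card (bad x))"
    using W by (intro card_UN_le) auto
  also have "\<dots> \<le> (\<Sum>x\<in>W - {0}. nat (8 * l))"
    by (intro sum_mono card_bad) auto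
  also have "\<dots> \<le> card W * nat (8 * l)"
    using W by (simp add: card_mono)
  finally have "int (card (\<Union>x\<in>W - {0}. bad x)) \<le> int (card W * nat (8 * l))"
    by (simp only: zle_int)
  also have "\<dots> = w * (8 * l)" using l by (simp add: w_def)
  finally have "int (card (\<Union>x\<in>W - {0}. bad x)) \<le> w * (8 * l)" .
  then have "card (\<Union>x\<in>W - {0}. bad x) < card {0..<n}"
    using l_upper by (simp add: algebra_simps)
  moreover have "finite (\<Union>x\<in>W - {0}. bad x)"
    using W by (simp add: bad_def del: atLeastLessThan_iff)
  ultimately have "\<not> {0..<n} \<subseteq> (\<Union>x\<in>W - {0}. bad x)"
    using card_mono leD by blast
  then obtain q where q: "q \<in> {0..<n}" "q \<notin> (\<Union>x\<in>W - {0}. bad x)" by blast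
  show thesis
  proof (rule that)
    show "n > 0" using n w by linarith
    show "x = 0" if "x \<in> W" "\<bar>i\<bar> < 4 * l" "n dvd q * x + i" for x i
      using q that by (force simp: bad_def)
    have "real_of_int n \<le> of_int (16 * w * l)" using l_lower n by (subst of_int_le_iff) linarith
    then show "of_int n / (16 * real (card W)) \<le> of_int l"
      using w by (simp add: w_def field_simps)
  qed (use l ln in auto)
qed

text \<open>
Choose the dilation \<open>q\<close> for \<open>W = 5 B - 5 B\<close> and fatten \<open>q * B\<close> by the interval \<open>[0, l)\<close>.  The resulting set \<open>X\<close>
has density at least \<open>1 / (16 * C)\<close> modulo \<open>n\<close>, so for some set of at most \<open>r\<close> frequencies \<open>k\<close>,
\<open>2 X - 2 X\<close> contains modulo \<open>n\<close> all \<open>s\<close> for which every \<open>k * s / n\<close> is within \<open>1 / 4\<close> of an integer.  By the pigeonhole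
principle there is a difference \<open>d = b - b'\<close> such that every \<open>k * q * d / n\<close> is within \<open>1 / g\<close> of an integer; then
\<open>s = q * (j * d)\<close> qualifies for all \<open>j \<le> g / 4\<close>.

It remains to see that the congruences obtained are honest equations between integers.  This goes by induction on \<open>j\<close>: if
\<open>j * d\<close> lies in \<open>2 B - 2 B\<close>, then the discrepancy between \<open>(j + 1) * d\<close> and the element of \<open>2 B - 2 B\<close> found for it
lies in \<open>W\<close>, and its dilate is close to \<open>0\<close>, so the separation property makes it vanish.
\<close>
theorem progression_in_2B_minus_2B:
  fixes B :: "int set" and C :: real and g r :: nat
  assumes B: "finite B" "B \<noteq> {}"
    and small: "real (card (iterated_sumset 5 B + iterated_sumset 5 (uminus ` B))) \<le> C * real (card B)"
    and r: "512 * C\<^sup>2 \<le> real r" and g: "g > 0" "g ^ r < card B"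
  obtains d where "d \<noteq> 0"
    "\<And>j. 4 * j \<le> g \<Longrightarrow> int j * d \<in> iterated_sumset 2 B + iterated_sumset 2 (uminus ` B)"
proof -
  define W where "W = iterated_sumset 5 B + iterated_sumset 5 (uminus ` B)"
  define T where "T = iterated_sumset 2 B + iterated_sumset 2 (uminus ` B)"
  have W_I: "a1 + a2 + a3 + a4 + a5 - (c1 + c2 + c3 + c4 + c5) \<in> W"
    if "{a1, a2, a3, a4, a5, c1, c2, c3, c4, c5} \<subseteq> B" for a1 a2 a3 a4 a5 c1 c2 c3 c4 c5
  proof -
    have "(a1 + (a2 + (a3 + (a4 + a5)))) + (- c1 + (- c2 + (- c3 + (- c4 + - c5)))) \<in> W"
      unfolding W_def iterated_sumset_5 using that by (intro set_plus_intro imageI) auto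
    then show ?thesis by (simp add: algebra_simps)
  qed
  have T_iff: "y \<in> T \<longleftrightarrow> (\<exists>b1\<in>B. \<exists>b2\<in>B. \<exists>b3\<in>B. \<exists>b4\<in>B. y = b1 + b2 - b3 - b4)" for y
  proof
    assume "y \<in> T"
    then obtain b1 b2 b3 b4 where b: "b1 \<in> B" "b2 \<in> B" "b3 \<in> B" "b4 \<in> B" "y = (b1 + b2) + (- b3 + - b4)"
      unfolding T_def iterated_sumset_2 by (auto elim!: set_plus_elim)
    then have "y = b1 + b2 - b3 - b4" by simp
    then show "\<exists>b1\<in>B. \<exists>b2\<in>B. \<exists>b3\<in>B. \<exists>b4\<in>B. y = b1 + b2 - b3 - b4"
      using b by blast
  next
    assume "\<exists>b1\<in>B. \<exists>b2\<in>B. \<exists>b3\<in>B. \<exists>b4\<in>B. y = b1 + b2 - b3 - b4"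
    then obtain b1 b2 b3 b4 where b: "{b1, b2, b3, b4} \<subseteq> B" "y = (b1 + b2) + (- b3 + - b4)" by auto
    then show "y \<in> T"
      unfolding T_def iterated_sumset_2 b(2) by (intro set_plus_intro imageI) auto
  qed
  obtain b0 where b0: "b0 \<in> B" using B by blast
  have W: "finite W" "W \<noteq> {}"
  proof -
    show "finite W" using B by (simp add: W_def finite_set_plus finite_iterated_sumset)
    show "W \<noteq> {}" using W_I[of b0 b0 b0 b0 b0 b0 b0 b0 b0 b0] b0 by blast
  qed
  obtain n l q :: int where nlq: "n > 0" "l > 0" "l < n" "of_int n / (16 * real (card W)) \<le> of_int l"
    and sep: "\<And>x i. \<lbrakk>x \<in> W; \<bar>i\<bar> < 4 * l; n dvd q * x + i\<rbrakk> \<Longrightarrow> x = 0"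
    using separating_dilation[OF W] by blast

  define M where "M = real (card B)"
  have M: "M > 0" using B by (simp add: M_def card_gt_0_iff)
  define h where "h = (\<lambda>(b, i). q * b + i)"
  define X where "X = h ` (B \<times> {0..<l})"
  have h_inj: "p = p'" if p: "p \<in> B \<times> {0..<l}" "p' \<in> B \<times> {0..<l}" "h p mod n = h p' mod n" for p p'
  proof -
    obtain b i b' i' where e: "p = (b, i)" "p' = (b', i')" by fastforce
    have "n dvd (q * b + i) - (q * b' + i')"
      using p(3) unfolding e h_def by (simp add: mod_eq_dvd_iff)
    then have "n dvd q * (b - b') + (i - i')" by (simp add: algebra_simps)
    moreover have "b - b' \<in> W"
      using W_I[of b b0 b0 b0 b0 b' b0 b0 b0 b0] p b0 by (simp add: e)
    ultimately have "b - b' = 0" using p by (intro sep[of _ "i - i'"]) (auto simp: e)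
    moreover from this \<open>n dvd q * (b - b') + (i - i')\<close> have "n dvd i - i'" by simp
    then have "i mod n = i' mod n" by (simp add: mod_eq_dvd_iff)
    then have "i = i'" using p nlq by (simp add: e)
    ultimately show ?thesis by (simp add: e)
  qed
  have inj: "inj_on (\<lambda>x. x mod n) X"
    unfolding X_def using h_inj by (auto intro!: inj_onI)
  have "inj_on h (B \<times> {0..<l})" using h_inj by (intro inj_onI) metis
  then have cardX: "real (card X) = M * of_int l"
    using nlq by (simp add: X_def card_image card_cartesian_product M_def)
  have X: "finite X" "X \<noteq> {}" using B nlq by (auto simp: X_def)
  obtain S where S: "S \<subseteq> {0..<n}" "real (card S) * (real (card X) / of_int n)\<^sup>2 \<le> 2"
      and bog: "\<And>s. (\<And>k. k \<in> S \<Longrightarrow> cos (2 * pi * (of_int (k * s) / of_int n)) \<ge> 0) \<Longrightarrow>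
        \<exists>x1\<in>X. \<exists>x2\<in>X. \<exists>x3\<in>X. \<exists>x4\<in>X. n dvd x1 + x2 - x3 - x4 - s"
    using bogolyubov[OF nlq(1) X inj] by blast
  have finS: "finite S" using S finite_subset by blast
  have cardW: "real (card W) > 0" using W by (simp add: card_gt_0_iff)
  have C: "C > 0"
  proof -
    have "0 < C * M" using small cardW unfolding W_def M_def by linarith
    then show ?thesis using M by (simp add: zero_less_mult_iff)
  qed
  have "1 / (16 * C) \<le> real (card X) / of_int n"
  proof -
    have "1 / (16 * C) \<le> M / (16 * real (card W))"
      using small C cardW by (simp add: W_def M_def field_simps)
    also have "\<dots> = M * (of_int n / (16 * real (card W))) / of_int n"
      using nlq(1) by simp
    also have "\<dots> \<le> M * of_int l / of_int n"
      using nlq M by (intro divide_right_mono mult_left_mono) auto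
    finally show ?thesis by (simp add: cardX)
  qed
  then have "(1 / (16 * C))\<^sup>2 \<le> (real (card X) / of_int n)\<^sup>2"
    using C by (intro power_mono) auto
  then have "real (card S) * (1 / (16 * C))\<^sup>2 \<le> real (card S) * (real (card X) / of_int n)\<^sup>2"
    by (rule mult_left_mono) simp
  then have "real (card S) * (1 / (16 * C))\<^sup>2 \<le> 2" using S(2) by linarith
  then have "real (card S) \<le> 512 * C\<^sup>2"
    using C by (simp add: power_divide power_mult_distrib field_simps)
  then have cardS: "card S \<le> r" using r by linarith

  \<comment> \<open>cut the torus of the values \<open>y k b\<close> modulo 1, \<open>k \<in> S\<close>, into fewer than \<open>card B\<close> boxes of side \<open>1 / g\<close>\<close>
  define y where "y k b = real_of_int (k * (q * b)) / of_int n" for k b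
  define \<phi> where "\<phi> b = (\<lambda>k\<in>S. \<lfloor>real g * frac (y k b)\<rfloor>)" for b
  have "\<phi> ` B \<subseteq> S \<rightarrow>\<^sub>E {0..<int g}"
    using g(1) frac_lt_1 frac_ge_0
    by (auto simp: \<phi>_def floor_less_iff intro!: mult_nonneg_nonneg) 
  then have "card (\<phi> ` B) \<le> card (S \<rightarrow>\<^sub>E {0..<int g})"
    using finS by (intro card_mono finite_PiE) auto
  also have "\<dots> = g ^ card S" using finS by (simp add: card_PiE)
  also have "\<dots> \<le> g ^ r" using g(1) cardS by (intro power_increasing) auto
  also have "\<dots> < card B" by (rule g)
  finally have "\<not> inj_on \<phi> B" by (rule pigeonhole)
  then obtain b b' where bb': "b \<in> B" "b' \<in> B" "b \<noteq> b'" "\<phi> b = \<phi> b'"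
    by (auto simp: inj_on_def)
  define d where "d = b - b'"
  have cos_nonneg: "cos (2 * pi * (of_int (k * (q * (int j * d))) / of_int n)) \<ge> 0"
    if k: "k \<in> S" and j: "4 * j \<le> g" for k j
  proof -
    define \<tau> where "\<tau> = frac (y k b) - frac (y k b')"
    define m where "m = \<lfloor>y k b\<rfloor> - \<lfloor>y k b'\<rfloor>"
    have "\<lfloor>real g * frac (y k b)\<rfloor> = \<lfloor>real g * frac (y k b')\<rfloor>"
      using fun_cong[OF bb'(4), of k] k by (simp add: \<phi>_def)
    then have "\<bar>real g * frac (y k b) - real g * frac (y k b')\<bar> < 1" by linarith
    then have "\<bar>real g * \<tau>\<bar> < 1" by (simp add: \<tau>_def right_diff_distrib)
    then have \<tau>: "real g * \<bar>\<tau>\<bar> < 1" by (simp add: abs_mult)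
    have "of_int (k * (q * (int j * d))) / of_int n = real j * (y k b - y k b')"
      by (simp add: y_def d_def algebra_simps diff_divide_distrib)
    also have "y k b - y k b' = of_int m + \<tau>"
      by (simp add: m_def \<tau>_def frac_def)
    finally have "2 * pi * (of_int (k * (q * (int j * d))) / of_int n) = 2 * pi * (real j * \<tau>) + 2 * pi * of_int (int j * m)"
      by (simp add: algebra_simps)
    then have "cos (2 * pi * (of_int (k * (q * (int j * d))) / of_int n)) = cos (2 * pi * (real j * \<tau>))"
      by (simp only: cos_add sin_int_2pin cos_int_2pin)
    also have "\<dots> \<ge> 0"
    proof -
      have "4 * (real j * \<bar>\<tau>\<bar>) \<le> real g * \<bar>\<tau>\<bar>"
        using j by (simp add: mult_right_mono flip: mult.assoc)
      then have "\<bar>real j * \<tau>\<bar> \<le> 1 / 4" using \<tau> by (simp add: abs_mult)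
      then have "2 * pi * \<bar>real j * \<tau>\<bar> \<le> 2 * pi * (1 / 4)" by (intro mult_left_mono) auto
      then have "\<bar>2 * pi * (real j * \<tau>)\<bar> \<le> pi / 2" by (simp add: abs_mult)
      then have "- (pi / 2) \<le> 2 * pi * (real j * \<tau>)" "2 * pi * (real j * \<tau>) \<le> pi / 2"
        by (simp_all only: abs_le_iff) linarith+
      then show ?thesis by (rule cos_ge_zero)
    qed
    finally show ?thesis .
  qed
  have "int j * d \<in> T" if "4 * j \<le> g" for j
    using that
  proof (induction j)
    case 0
    have "0 = b0 + b0 - b0 - b0" by simp
    then show ?case unfolding T_iff using b0 by (intro bexI[of _ b0]) simp_all
  next
    case (Suc j)
    then obtain c1 c2 c3 c4 where c: "c1 \<in> B" "c2 \<in> B" "c3 \<in> B" "c4 \<in> B" "int j * d = c1 + c2 - c3 - c4"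
      unfolding T_iff by auto
    obtain x1 x2 x3 x4 where x: "x1 \<in> X" "x2 \<in> X" "x3 \<in> X" "x4 \<in> X"
        "n dvd x1 + x2 - x3 - x4 - q * (int (Suc j) * d)"
      using bog[of "q * (int (Suc j) * d)"] cos_nonneg Suc.prems by metis
    obtain b1 i1 where 1: "b1 \<in> B" "0 \<le> i1" "i1 < l" "x1 = q * b1 + i1" using x(1) by (auto simp: X_def h_def)
    obtain b2 i2 where 2: "b2 \<in> B" "0 \<le> i2" "i2 < l" "x2 = q * b2 + i2" using x(2) by (auto simp: X_def h_def)
    obtain b3 i3 where 3: "b3 \<in> B" "0 \<le> i3" "i3 < l" "x3 = q * b3 + i3" using x(3) by (auto simp: X_def h_def)
    obtain b4 i4 where 4: "b4 \<in> B" "0 \<le> i4" "i4 < l" "x4 = q * b4 + i4" using x(4) by (auto simp: X_def h_def)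
    have Suc_j: "int (Suc j) * d = c1 + c2 - c3 - c4 + b - b'"
      using c(5) by (simp add: d_def algebra_simps)
    have "b1 + b2 - b3 - b4 - int (Suc j) * d = b1 + b2 + c3 + c4 + b' - (b3 + b4 + c1 + c2 + b)"
      using Suc_j by simp
    also have "\<dots> \<in> W" using 1 2 3 4 c bb' by (intro W_I) auto
    finally have inW: "b1 + b2 - b3 - b4 - int (Suc j) * d \<in> W" .
    have "n dvd q * (b1 + b2 - b3 - b4 - int (Suc j) * d) + (i1 + i2 - i3 - i4)"
      using x(5) unfolding 1(4) 2(4) 3(4) 4(4) by (simp add: algebra_simps)
    then have "b1 + b2 - b3 - b4 - int (Suc j) * d = 0"
      using 1 2 3 4 by (intro sep[OF inW]) auto
    then have "int (Suc j) * d = b1 + b2 - b3 - b4" by simp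
    then show ?case unfolding T_iff using 1 2 3 4 by blast
  qed
  moreover have "d \<noteq> 0" using bb' by (simp add: d_def)
  ultimately show thesis using that unfolding T_def by blast
qed

text \<open>
Let \<open>Q\<close> be the progression found inside \<open>2 B - 2 B\<close>.  The set \<open>B - Q\<close> is contained in a translate of
\<open>5 B - 5 B\<close>, so the \<open>card B * card Q\<close> pairs in \<open>B \<times> Q\<close> have at most \<open>C * card B\<close> differences.  A most popular
difference gives a translate of \<open>Q\<close> that meets \<open>B\<close> in at least \<open>card Q / C\<close> points.
\<close>
lemma dense_progression_of_small_iterated_sumsets:
  fixes B :: "int set" and C :: real and g r :: nat
  assumes B: "finite B" "B \<noteq> {}"
    and small: "real (card (iterated_sumset 5 B + iterated_sumset 5 (uminus ` B))) \<le> C * real (card B)"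
    and r: "512 * C\<^sup>2 \<le> real r" and g: "g > 0" "g ^ r < card B"
  obtains P where "arith_progression P" "card P = g div 4 + 1"
    "real (card P) \<le> C * real (card (B \<inter> P))"
proof -
  define W where "W = iterated_sumset 5 B + iterated_sumset 5 (uminus ` B)"
  obtain d where d: "d \<noteq> 0"
    "\<And>j. 4 * j \<le> g \<Longrightarrow> int j * d \<in> iterated_sumset 2 B + iterated_sumset 2 (uminus ` B)"
    using progression_in_2B_minus_2B[OF B small r g] by blast
  define L where "L = g div 4 + 1"
  obtain b0 where b0: "b0 \<in> B" using B by blast
  have finW: "finite W" using B by (simp add: W_def finite_set_plus finite_iterated_sumset)
  have inW: "b - int j * d - b0 \<in> W" if "b \<in> B" "j < L" for b j
  proof -
    have "4 * j \<le> g" using that(2) by (simp add: L_def)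
    from d(2)[OF this] obtain b1 b2 b3 b4
      where b: "b1 \<in> B" "b2 \<in> B" "b3 \<in> B" "b4 \<in> B" "int j * d = (b1 + b2) + (- b3 + - b4)"
      unfolding iterated_sumset_2 by (auto elim!: set_plus_elim)
    have "(b + (b3 + (b4 + (b0 + b0)))) + (- b1 + (- b2 + (- b0 + (- b0 + - b0)))) \<in> W"
      unfolding W_def iterated_sumset_5 using that b b0 by (intro set_plus_intro imageI)
    moreover have "b - int j * d - b0 = (b + (b3 + (b4 + (b0 + b0)))) + (- b1 + (- b2 + (- b0 + (- b0 + - b0))))"
      using b(5) by linarith
    ultimately show ?thesis by metis
  qed
  define fib where "fib w = {p \<in> B \<times> {..<L}. fst p - int (snd p) * d - b0 = w}" for w
  have cB: "real (card B) > 0" using B by (simp add: card_gt_0_iff)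
  have cW: "card W > 0" using inW[OF b0, of 0] finW by (auto simp: card_gt_0_iff L_def)
  have "\<exists>w\<in>W. real (card B) * real L \<le> real (card W) * real (card (fib w))"
  proof (rule ccontr)
    assume "\<not> ?thesis"
    then have "(\<Sum>w\<in>W. real (card W) * real (card (fib w))) < (\<Sum>w\<in>W. real (card B) * real L)"
      using finW cW by (intro sum_strict_mono) (auto simp: not_le)
    then have "real (card W) * (\<Sum>w\<in>W. real (card (fib w))) < real (card W) * (real (card B) * real L)"
      by (simp add: sum_distrib_left)
    also have "(\<Sum>w\<in>W. real (card (fib w))) = real (card (\<Union>w\<in>W. fib w))"
      using finW B by (subst card_UN_disjoint) (auto simp: fib_def)
    also have "(\<Union>w\<in>W. fib w) = B \<times> {..<L}"
      using inW by (auto simp: fib_def)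
    finally show False by (simp add: card_cartesian_product)
  qed
  then obtain w where w: "real (card B) * real L \<le> real (card W) * real (card (fib w))" by blast
  define P where "P = {(w + b0) + int i * d | i. i < L}"
  have P_image: "P = (\<lambda>i. (w + b0) + int i * d) ` {..<L}" by (auto simp: P_def)
  have cardP: "card P = L"
    unfolding P_image using d by (subst card_image) (auto intro: inj_onI)
  have "card (fib w) \<le> card (B \<inter> P)"
  proof (rule card_inj_on_le[of fst])
    show "inj_on fst (fib w)" using d by (auto intro!: inj_onI simp: fib_def)
    show "fst ` fib w \<subseteq> B \<inter> P" by (auto simp: fib_def P_def algebra_simps)
    show "finite (B \<inter> P)" using B by simp
  qed
  then have "real (card W) * real (card (fib w)) \<le> C * real (card B) * real (card (B \<inter> P))"
    using small by (intro mult_mono) (auto simp: W_def intro: order_trans[rotated])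
  then have "real (card B) * real L \<le> real (card B) * (C * real (card (B \<inter> P)))"
    using w by (simp add: mult_ac)
  then have "real L \<le> C * real (card (B \<inter> P))" using cB by simp
  moreover have "arith_progression P"
    unfolding arith_progression_def P_def
    by (rule exI[of _ "w + b0"], rule exI[of _ d], rule exI[of _ L]) (use d in \<open>simp add: L_def\<close>)
  ultimately show thesis using that[of P] cardP by (simp add: L_def)
qed

section \<open>Sets with small transform norm\<close>

lemma initial_segment_exists:
  fixes A :: "'a::linorder set"
  assumes "finite A" "M \<le> card A"
  shows "\<exists>B\<subseteq>A. card B = M \<and> (\<forall>b\<in>B. \<forall>a\<in>A - B. b < a)"
  using assms(2)
proof (induction M)
  case 0
  then show ?case by (intro exI[of _ "{}"]) auto
next
  case (Suc M)
  then obtain B where B: "B \<subseteq> A" "card B = M" "\<And>b a. \<lbrakk>b \<in> B; a \<in> A - B\<rbrakk> \<Longrightarrow> b < a" by auto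
  have fin: "finite B" "finite (A - B)" using B assms finite_subset by auto
  have "A - B \<noteq> {}"
  proof
    assume "A - B = {}"
    then have "A = B" using B(1) by blast
    then show False using B(2) Suc.prems by simp
  qed
  then have Min: "Min (A - B) \<in> A - B" "\<And>a. a \<in> A - B \<Longrightarrow> Min (A - B) \<le> a"
    using Min_in[of "A - B"] Min_le[of "A - B"] fin by blast+
  have "b < a" if b: "b \<in> insert (Min (A - B)) B" and a: "a \<in> A - insert (Min (A - B)) B" for a b
  proof (cases "b = Min (A - B)")
    case True
    have "b \<le> a" "b \<noteq> a" using a Min(2)[of a] True by blast+
    then show ?thesis by simp
  next
    case False
    then show ?thesis using a b B(3)[of b a] by blast
  qed
  moreover have "insert (Min (A - B)) B \<subseteq> A" using B(1) Min(1) by blast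
  moreover have "card (insert (Min (A - B)) B) = Suc M"
    using fin(1) B(2) Min(1) by (subst card_insert_disjoint) blast+
  ultimately show ?case by blast
qed

text \<open>
Apply the lower bound for the norm to the initial segments of \<open>A\<close> of size \<open>4 ^ k\<close> with \<open>k\<close> in the upper half of
the range allowed by \<open>card A\<close>.  There are at least \<open>ln (card A) / (2 * ln 4)\<close> of them, so with
\<open>sqrt \<delta> = 1 / (96 * K)\<close> they cannot all have energy below \<open>\<delta>\<close> times the cube of their size.
\<close>
lemma high_energy_subset_of_small_L1_norm:
  fixes A :: "int set" and K :: real
  assumes A: "finite A" and N: "card A \<ge> 64" and K: "K > 0"
    and L1: "indicator_hat_L1 A \<le> K * ln (real (card A))"
  obtains B where "B \<subseteq> A" "B \<noteq> {}" "card A \<le> card B ^ 4"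
    "(1 / (96 * K))\<^sup>2 * real (card B) ^ 3 \<le> real (additive_energy B)"
proof -
  define N where "N = card A"
  define \<delta> where "\<delta> = (1 / (96 * K))\<^sup>2"
  have \<delta>: "\<delta> > 0" "sqrt \<delta> = 1 / (96 * K)" using K by (auto simp: \<delta>_def)
  define J where "J = Max {j. 4 ^ j \<le> N}"
  have "j < N" if "4 ^ j \<le> N" for j :: nat
  proof -
    have "(2::nat) ^ j \<le> 4 ^ j" by (intro power_mono) auto
    then show ?thesis using that less_exp[of j] by linarith
  qed
  then have "{j. 4 ^ j \<le> N} \<subseteq> {..<N}" by blast
  then have finJ: "finite {j. 4 ^ j \<le> N}" by (rule finite_subset) simp
  have three: "3 \<in> {j. 4 ^ j \<le> N}" using \<open>card A \<ge> 64\<close> by (simp add: N_def)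
  then have "J \<in> {j. 4 ^ j \<le> N}" unfolding J_def using finJ by (intro Max_in) blast+
  moreover have "3 \<le> J" unfolding J_def by (rule Max_ge[OF finJ three])
  ultimately have J: "4 ^ J \<le> N" "J \<ge> 3" by simp_all
  have J_max: "N < 4 ^ Suc J"
  proof (rule ccontr)
    assume "\<not> ?thesis"
    then have "Suc J \<in> {j. 4 ^ j \<le> N}" by simp
    then have "Suc J \<le> J" unfolding J_def using finJ Max_ge by blast
    then show False by simp
  qed
  define good where "good k B \<longleftrightarrow> B \<subseteq> A \<and> card B = 4 ^ k \<and> (\<forall>b\<in>B. \<forall>a\<in>A - B. b < a)" for k B
  have "\<exists>B. good k B" if "k < Suc J" for k
  proof -
    have "(4::nat) ^ k \<le> 4 ^ J" using that by (intro power_increasing) auto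
    also have "\<dots> \<le> card A" using J(1) by (simp only: N_def)
    finally show ?thesis
      using initial_segment_exists[OF A] unfolding good_def by blast
  qed
  then have "\<exists>B. \<forall>k. k < Suc J \<longrightarrow> good k (B k)" by (intro choice) blast
  then obtain B where good: "\<And>k. k < Suc J \<Longrightarrow> good k (B k)" by blast
  then have B: "\<And>k. k < Suc J \<Longrightarrow> B k \<subseteq> A" "\<And>k. k < Suc J \<Longrightarrow> card (B k) = 4 ^ k"
      "\<And>k b a. \<lbrakk>k < Suc J; b \<in> B k; a \<in> A - B k\<rbrakk> \<Longrightarrow> b < a"
    unfolding good_def by blast+
  define m where "m = J div 2"
  have "\<exists>k\<in>{m..<Suc J}. \<delta> * (4 ^ k) ^ 3 < real (additive_energy (B k))"
  proof (rule ccontr)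
    assume "\<not> ?thesis"
    then have low: "real (additive_energy (B k)) \<le> \<delta> * (4 ^ k) ^ 3" if "k \<in> {m..<Suc J}" for k
      using that by (metis not_less)
    have "real (Suc J - m) / (24 * sqrt \<delta>) \<le> indicator_hat_L1 A"
    proof (rule L1_norm_ge_of_low_energy_initial_segments[OF A \<delta>(1) _ _ _ low])
      fix k assume k: "k \<in> {m..<Suc J}"
      show "B k \<subseteq> A" "card (B k) = 4 ^ k" using B(1,2)[of k] k by simp_all
      show "b < a" if "b \<in> B k" "a \<in> A - B k" for a b using B(3)[OF _ that] k by simp
    qed
    also have "\<dots> \<le> K * ln (real N)" using L1 by (simp add: N_def)
    also have "\<dots> < K * (2 * real (Suc J))"
    proof -
      have "ln (real N) < ln (4 ^ Suc J)"
      proof (rule ln_less_cancel_iff[THEN iffD2])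
        show "0 < real N" using \<open>card A \<ge> 64\<close> by (simp add: N_def)
        have "real N < real (4 ^ Suc J)" using J_max by (simp only: of_nat_less_iff)
        then show "real N < 4 ^ Suc J" by simp
      qed simp
      also have "\<dots> = real (Suc J) * ln (2 ^ 2)" by (subst ln_realpow) simp_all
      also have "\<dots> \<le> real (Suc J) * 2"
      proof (rule mult_left_mono)
        show "ln (2 ^ 2 :: real) \<le> 2" using ln_2_less_1 by (subst ln_realpow) simp_all
      qed simp
      finally show ?thesis using K by simp
    qed
    finally have "4 * real (Suc J - m) < 2 * real (Suc J)"
      using K by (simp add: \<delta>(2))
    then show False by (simp add: m_def of_nat_diff)
  qed
  then obtain k where k: "k \<in> {m..<Suc J}" "\<delta> * (4 ^ k) ^ 3 < real (additive_energy (B k))" by blast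
  show thesis
  proof (rule that[of "B k"])
    have "Suc J \<le> k * 4" using k(1) J(2) by (auto simp: m_def)
    then have "(4::nat) ^ Suc J \<le> 4 ^ (k * 4)" by (intro power_increasing) auto
    then show "card A \<le> card (B k) ^ 4" using J_max k B(2)[of k] by (simp add: N_def power_mult)
    show "B k \<noteq> {}" using B(2)[of k] k by force
    show "(1 / (96 * K))\<^sup>2 * real (card (B k)) ^ 3 \<le> real (additive_energy (B k))"
      using k B(2)[of k] by (simp add: \<delta>_def)
  qed (use B k in auto)
qed

lemma arith_progression_pair:
  assumes "finite A" "card A \<ge> 2"
  obtains P where "arith_progression P" "card P = 2" "P \<subseteq> A"
proof -
  obtain a b where ab: "a \<in> A" "b \<in> A" "a \<noteq> b"
    using assms by (metis Suc_le_eq card_le_Suc0_iff_eq not_less_eq_eq numeral_2_eq_2)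
  have "(\<lambda>i. a + int i * (b - a)) ` {..<2} = {a, b}"
    by (simp add: numeral_2_eq_2 lessThan_Suc insert_commute)
  then have "{a, b} = {a + int i * (b - a) | i. i < 2}" by auto
  then have "arith_progression {a, b}"
    unfolding arith_progression_def using ab(3)
    by (intro exI[of _ a] exI[of _ "b - a"] exI[of _ 2]) simp
  then show thesis using ab that[of "{a, b}"] by simp
qed

lemma power_powr_inverse:
  fixes x :: real
  assumes "x > 0" "n > 0"
  shows "(x ^ n) powr (1 / real n) = x"
  using assms powr_powr[of x "real n" "1 / real n"] by (simp add: powr_realpow)

theorem corollary1p3:
  shows "\<exists>N0::nat. \<forall>K::real. K > 0 \<longrightarrow>
    (\<exists>c::real. c > 0 \<and>
      (\<forall>(N::nat) (A::int set).
        N \<ge> N0 \<and> finite A \<and> card A = N \<and> indicator_hat_L1 A \<le> K * ln (real N) \<longrightarrow>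
        (\<exists>P::int set. arith_progression P \<and>
           real (card P) \<ge> real N powr c \<and>
           real (card (A \<inter> P)) \<ge> c * real (card P))))"
proof (intro exI[of _ "2::nat"] allI impI)
  fix K :: real assume K: "K > 0"
  define \<delta> where "\<delta> = (1 / (96 * K))\<^sup>2"
  have \<delta>: "\<delta> > 0" using K by (simp add: \<delta>_def)
  define C where "C = (4096 / (\<delta> / 2) ^ 10) ^ 10"
  have C: "C > 0" using \<delta> by (simp add: C_def)
  define r where "r = nat \<lceil>512 * C\<^sup>2\<rceil>"
  have r: "512 * C\<^sup>2 \<le> real r" "r > 0" using C by (auto simp: r_def)
  define N1 where "N1 = 64 + 4 ^ (16 * r) + (8 / \<delta>) ^ 8"
  have N1: "N1 \<ge> 64" "N1 \<ge> 4 ^ (16 * r)" "N1 \<ge> (8 / \<delta>) ^ 8" using \<delta> by (auto simp: N1_def)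
  \<comment> \<open>\<open>ln 2 / ln N1\<close> serves the sizes up to \<open>N1\<close>, for which two elements of \<open>A\<close> are a long enough progression;\<close>
  \<comment> \<open>\<open>1 / C\<close> is the density and \<open>1 / (16 * r)\<close> the exponent of the length for larger sizes\<close>
  define c where "c = min (min 1 (1 / C)) (min (1 / (16 * real r)) (ln 2 / ln N1))"
  have c: "c > 0" "c \<le> 1" "c \<le> 1 / C" "c \<le> 1 / (16 * real r)" "c \<le> ln 2 / ln N1"
  proof -
    have "ln N1 > 0" using N1(1) by simp
    then show "c > 0" using C r(2) by (simp add: c_def)
  qed (simp_all add: c_def)

  have "\<exists>P. arith_progression P \<and> real (card P) \<ge> real N powr c \<and> real (card (A \<inter> P)) \<ge> c * real (card P)"
    if N: "N \<ge> 2" and A: "finite A" "card A = N" and L1: "indicator_hat_L1 A \<le> K * ln (real N)"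
    for N :: nat and A :: "int set"
  proof (cases "real N \<le> N1")
    case True
    obtain P where P: "arith_progression P" "card P = 2" "P \<subseteq> A"
      using arith_progression_pair[of A] A N by auto
    have "ln (real N powr c) \<le> ln 2"
    proof -
      have "c * ln (real N) \<le> ln 2 / ln N1 * ln N1"
        using c N N1 True by (intro mult_mono) auto
      then show ?thesis using N N1 by (simp add: ln_powr)
    qed
    then have "real N powr c \<le> 2" using N by (subst (asm) ln_le_cancel_iff) auto
    moreover have "A \<inter> P = P" using P by auto
    ultimately show ?thesis using P c by (intro exI[of _ P]) auto
  next
    case False
    then have NN: "real N > N1" by simp
    have NN64: "card A \<ge> 64" using NN N1(1) A by linarith
    obtain B where B: "B \<subseteq> A" "B \<noteq> {}" "card A \<le> card B ^ 4"
        "\<delta> * real (card B) ^ 3 \<le> real (additive_energy B)"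
      using high_energy_subset_of_small_L1_norm[OF A(1) NN64 K] L1 A unfolding \<delta>_def by blast
    have finB: "finite B" using B A finite_subset by blast
    obtain B' where B': "B' \<subseteq> B" "B' \<noteq> {}" "\<delta> / 8 * real (card B) \<le> real (card B')"
        "real (card (B' + uminus ` B')) \<le> 4096 / (\<delta> / 2) ^ 10 * real (card B')"
      using balog_szemeredi_gowers[OF finB B(2) \<delta> B(4)] by blast
    have finB': "finite B'" using B' finB finite_subset by blast
    have small: "real (card (iterated_sumset 5 B' + iterated_sumset 5 (uminus ` B'))) \<le> C * real (card B')"
      using card_iterated_difference_set_le[OF finB' B'(2,4), of 5] by (simp add: C_def)

    \<comment> \<open>\<open>B'\<close> has at least \<open>\<delta> / 8 * N powr (1 / 4)\<close> elements, so with this \<open>t\<close> the condition \<open>g ^ r < card B'\<close> holds for large \<open>N\<close>\<close>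
    define t where "t = real N powr (1 / (8 * real r))"
    have t1: "t \<ge> 1" using N r by (simp add: t_def ge_one_powr_ge_zero)
    define g where "g = nat \<lfloor>t\<rfloor>"
    have g: "g > 0" "real g \<le> t" "t < real g + 1"
    proof -
      have "1 \<le> \<lfloor>t\<rfloor>" using t1 by simp
      then show "g > 0" by (simp add: g_def)
      have "real g = of_int \<lfloor>t\<rfloor>" using \<open>1 \<le> \<lfloor>t\<rfloor>\<close> by (simp add: g_def)
      then show "real g \<le> t" "t < real g + 1" by linarith+
    qed
    have "real (g ^ r) \<le> t ^ r" using g by (simp add: power_mono)
    also have "t ^ r = real N powr (1 / 8)"
      using N r by (simp add: t_def powr_power)
    also have "\<dots> < real (card B')"
    proof -
      have "8 / \<delta> < real N powr (1 / 8)"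
      proof -
        have "8 / \<delta> = ((8 / \<delta>) ^ 8) powr (1 / 8)"
          using power_powr_inverse[of "8 / \<delta>" 8] \<delta> by simp
        also have "\<dots> < real N powr (1 / 8)"
          using NN N1 \<delta> by (intro powr_less_mono2) auto
        finally show ?thesis .
      qed
      then have "1 < \<delta> / 8 * real N powr (1 / 8)" using \<delta> by (simp add: field_simps)
      then have "1 * real N powr (1 / 8) < \<delta> / 8 * real N powr (1 / 8) * real N powr (1 / 8)"
        using N by (intro mult_strict_right_mono) auto
      also have "\<dots> = \<delta> / 8 * real N powr (1 / 4)" by (simp flip: powr_add)
      also have "\<dots> \<le> \<delta> / 8 * real (card B)"
      proof -
        have "real N \<le> real (card B) ^ 4" using B(3) A by (simp flip: of_nat_power)
        then have "real N powr (1 / 4) \<le> (real (card B) ^ 4) powr (1 / 4)"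
          using N by (intro powr_mono2) auto
        also have "\<dots> = real (card B)"
          using power_powr_inverse[of "real (card B)" 4] B(2) finB by (simp add: card_gt_0_iff)
        finally show ?thesis using \<delta> by (intro mult_left_mono) auto
      qed
      also note B'(3)
      finally show ?thesis by simp
    qed
    finally have "g ^ r < card B'" by simp
    from dense_progression_of_small_iterated_sumsets[OF finB' B'(2) small r(1) g(1) this]
    obtain P where P: "arith_progression P" "card P = g div 4 + 1" "real (card P) \<le> C * real (card (B' \<inter> P))"
      by blast
    have "real N powr c \<le> real N powr (1 / (16 * real r))"
      using N c by (intro powr_mono) auto
    also have "\<dots> \<le> t / 4"
    proof -
      define s where "s = real N powr (1 / (16 * real r))"
      have "t = s * s" using r by (simp add: t_def s_def flip: powr_add)
      moreover have "4 \<le> s"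
      proof -
        have "4 = (4 ^ (16 * r)) powr (1 / (16 * real r))"
          using power_powr_inverse[of 4 "16 * r"] r by simp
        also have "\<dots> \<le> s"
          unfolding s_def
        proof (rule powr_mono2)
          show "4 ^ (16 * r) \<le> real N" using NN N1(2) by linarith
        qed (use r in simp_all)
        finally show ?thesis .
      qed
      ultimately show ?thesis using mult_right_mono[of 4 s s] by (simp add: s_def)
    qed
    also have "\<dots> \<le> real (card P)"
    proof -
      have "g + 1 \<le> 4 * card P" using P(2) by simp
      then show ?thesis using g(3) by linarith
    qed
    finally have len: "real N powr c \<le> real (card P)" .
    have "c * real (card P) \<le> 1 / C * (C * real (card (B' \<inter> P)))"
      using c C P(3) by (intro mult_mono) auto
    also have "\<dots> = real (card (B' \<inter> P))" using C by simp
    also have "\<dots> \<le> real (card (A \<inter> P))"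
      using B B' A by (intro of_nat_mono card_mono) auto
    finally show ?thesis using P len by blast
  qed
  then show "\<exists>c>0. \<forall>(N::nat) (A::int set).
      2 \<le> N \<and> finite A \<and> card A = N \<and> indicator_hat_L1 A \<le> K * ln (real N) \<longrightarrow>
      (\<exists>P. arith_progression P \<and> real N powr c \<le> real (card P) \<and> c * real (card P) \<le> real (card (A \<inter> P)))"
    using c(1) by blast
qed

end
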